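(* Let $\mathbf{A}=(a_{ij})\in\mathbb{H}^{m\times n}$, $\mathbf{W}\in\mathbb{H}^{n\times m}$, $\mathbf{U}=\mathbf{W}\mathbf{A}\in\mathbb{H}^{n\times n}$, $\mathbf{V}=\mathbf{A}\mathbf{W}\in\mathbb{H}^{m\times m}$ and $k=\max\{\mathrm{Ind}(\mathbf{A}\mathbf{W}),\mathrm{Ind}(\mathbf{W}\mathbf{A})\}$. For a square matrix $\mathbf{M}\in\mathbb{H}^{N\times N}$ with $\operatorname{rank}\mathbf{M}^{k+1}=\operatorname{rank}\mathbf{M}^{k}=r$, write $\mathbf{M}^{k}=(m_{ij}^{(k)})$, let $\hat{\mathbf{m}}_{.j}$ be the $j$th column of $(\mathbf{M}^{2k+1})^{*}\mathbf{M}^{k}$ and $\check{\mathbf{m}}_{i.}$ the $i$th row of $\mathbf{M}^{k}(\mathbf{M}^{2k+1})^{*}$, and set, for $1\le i,j\le N$, $$m_{ij}^{D,1}=\frac{\displaystyle\sum_{t=1}^{N}m_{it}^{(k)}\sum_{\beta\in J_{r,N}\{t\}}\mathrm{cdet}_{t}\left(\left((\mathbf{M}^{2k+1})^{*}\mathbf{M}^{2k+1}\right)_{.t}(\hat{\mathbf{m}}_{.j})\right)_{\beta}^{\beta}}{\displaystyle\sum_{\beta\in J_{r,N}}\left|\left((\mathbf{M}^{2k+1})^{*}\mathbf{M}^{2k+1}\right)_{\beta}^{\beta}\right|},$$ $$m_{ij}^{D,2}=\frac{\displaystyle\sum_{s=1}^{N}\left(\sum_{\alpha\in I_{r,N}\{s\}}\mathrm{rdet}_{s}\left(\left(\mathbf{M}^{2k+1}(\mathbf{M}^{2k+1})^{*}\right)_{s.}(\check{\mathbf{m}}_{i.})\right)_{\alpha}^{\alpha}\right)m_{sj}^{(k)}}{\displaystyle\sum_{\alpha\in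 I_{r,N}}\left|\left(\mathbf{M}^{2k+1}(\mathbf{M}^{2k+1})^{*}\right)_{\alpha}^{\alpha}\right|}.$$ Let $u_{ij}^{D,1},u_{ij}^{D,2}$ and $v_{ij}^{D,1},v_{ij}^{D,2}$ denote these quantities for $\mathbf{M}=\mathbf{U}$ (with $N=n$) and $\mathbf{M}=\mathbf{V}$ (with $N=m$), respectively. Then, for all $l,f\in\{1,2\}$, the W-weighted Drazin inverse $\mathbf{A}_{d,\mathbf{W}}=(a_{ij}^{d,\mathbf{W}})\in\mathbb{H}^{m\times n}$ has the determinantal representations $$a_{ij}^{d,\mathbf{W}}=\sum_{q=1}^{n}a_{iq}\left(\sum_{p=1}^{n}u_{qp}^{D,l}u_{pj}^{D,f}\right)\quad\text{and}\quad a_{ij}^{d,\mathbf{W}}=\sum_{q=1}^{m}\left(\sum_{p=1}^{m}v_{ip}^{D,l}v_{pq}^{D,f}\right)a_{qj}$$ for all $i=1,\dots,m$, $j=1,\dots,n$.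
   Context: $\mathbb{H}$ is the skew field of real quaternions, $\mathbb{H}^{m\times n}$ the $m\times n$ matrices over $\mathbb{H}$, $\mathbf{M}^{*}$ the conjugate transpose; $\mathbf{M}$ is Hermitian if $\mathbf{M}^{*}=\mathbf{M}$. Rank is the dimension of the right column space. For square $\mathbf{M}$, $\mathrm{Ind}(\mathbf{M})$ is the smallest nonnegative integer $k$ with $\operatorname{rank}\mathbf{M}^{k+1}=\operatorname{rank}\mathbf{M}^{k}$. W-weighted Drazin inverse: with $k=\max\{\mathrm{Ind}(\mathbf{A}\mathbf{W}),\mathrm{Ind}(\mathbf{W}\mathbf{A})\}$, $\mathbf{A}_{d,\mathbf{W}}$ is the unique $\mathbf{X}\in\mathbb{H}^{m\times n}$ with $(\mathbf{A}\mathbf{W})^{k+1}\mathbf{X}\mathbf{W}=(\mathbf{A}\mathbf{W})^{k}$, $\mathbf{X}\mathbf{W}\mathbf{A}\mathbf{W}\mathbf{X}=\mathbf{X}$, $\mathbf{A}\mathbf{W}\mathbf{X}=\mathbf{X}\mathbf{W}\mathbf{A}$. Row determinant: for $\mathbf{M}=(m_{pq})\in\mathbb{H}^{n\times n}$ and $1\le i\le n$, $$\mathrm{rdet}_{i}\mathbf{M}=\sum_{\sigma\in S_{n}}(-1)^{n-\rho}\,m_{i\,i_{k_1}}m_{i_{k_1}i_{k_1+1}}\cdots m_{i_{k_1+l_1}\,i}\cdots m_{i_{k_\rho}i_{k_\rho+1}}\cdots m_{i_{k_\rho+l_\rho}i_{k_\rho}},$$ where $\sigma=(i\,i_{k_1}i_{k_1+1}\dots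 i_{k_1+l_1})(i_{k_2}i_{k_2+1}\dots i_{k_2+l_2})\cdots(i_{k_\rho}i_{k_\rho+1}\dots i_{k_\rho+l_\rho})$ is written as a product of its $\rho$ disjoint cycles (fixed points included), the first cycle starts with $i$, each other cycle starts with its smallest element, and $i_{k_2}<i_{k_3}<\dots<i_{k_\rho}$. Column determinant: for $1\le j\le n$, $$\mathrm{cdet}_{j}\mathbf{M}=\sum_{\tau\in S_{n}}(-1)^{n-\rho}\,m_{j_{k_\rho}j_{k_\rho+l_\rho}}\cdots m_{j_{k_\rho+1}j_{k_\rho}}\cdots m_{j\,j_{k_1+l_1}}\cdots m_{j_{k_1+1}j_{k_1}}m_{j_{k_1}j},$$ where $\tau=(j_{k_\rho+l_\rho}\dots j_{k_\rho+1}j_{k_\rho})\cdots(j_{k_2+l_2}\dots j_{k_2+1}j_{k_2})(j_{k_1+l_1}\dots j_{k_1+1}j_{k_1}j)$, with $\rho$ the number of disjoint cycles (fixed points included), the last cycle ends with $j$, each other cycle ends with its smallest element, and $j_{k_2}<\dots<j_{k_\rho}$. For Hermitian $\mathbf{M}$ all $\mathrm{rdet}_i\mathbf{M}$ and $\mathrm{cdet}_j\mathbf{M}$ coincide and are real; this common value is $\det\mathbf{M}$. Notation: $\mathbf{M}_{.j}(\mathbf{b})$ (resp. $\mathbf{M}_{j.}(\mathbf{b})$) is $\mathbf{M}$ with its $j$th column (resp. row) replaced by $\mathbf{b}$. $\mathbf{M}_{\alpha}^{\alpha}$ is the principal submatrix with rows and columns indexed by $\alpha$; $|\mathbf{M}_{\alpha}^{\alpha}|$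 is its determinant when $\mathbf{M}$ is Hermitian. For $j\in\alpha$, $\mathrm{rdet}_j$ and $\mathrm{cdet}_j$ of a principal submatrix indexed by $\alpha$ are taken along the row, resp. column, with original index $j$. $I_{r,N}=J_{r,N}$ is the set of strictly increasing sequences (equivalently subsets) of $r$ elements of $\{1,\dots,N\}$, and $I_{r,N}\{j\}=J_{r,N}\{j\}$ is the subset of those containing $j$; these are defined for $1\le r\le N$, so $r\ge1$ is implicit. *)

theory Defs
  imports
    "HOL-Combinatorics.Combinatorics"
    "Jordan_Normal_Form.Matrix"
    "Jordan_Normal_Form.Determinant"
begin

section \<open>Real quaternions\<close>

datatype quat = Quat (qre: real) (qi: real) (qj: real) (qk: real)

instantiation quat :: ring_1
begin

definition "0 = Quat 0 0 0 0"
definition "1 = Quat 1 0 0 0"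
definition "x + y = Quat (qre x + qre y) (qi x + qi y) (qj x + qj y) (qk x + qk y)"
definition "x - y = Quat (qre x - qre y) (qi x - qi y) (qj x - qj y) (qk x - qk y)"
definition "- x = Quat (- qre x) (- qi x) (- qj x) (- qk x)"
definition "x * y = Quat
  (qre x * qre y - qi x * qi y - qj x * qj y - qk x * qk y)
  (qre x * qi y + qi x * qre y + qj x * qk y - qk x * qj y)
  (qre x * qj y - qi x * qk y + qj x * qre y + qk x * qi y)
  (qre x * qk y + qi x * qj y - qj x * qi y + qk x * qre y)"

lemmas quat_ring_defs = zero_quat_def one_quat_def plus_quat_def minus_quat_def
  uminus_quat_def times_quat_def

instance
  by standard (auto simp: quat_ring_defs algebra_simps)

end

instantiation quat :: real_algebra_1
begin

definition "scaleR r x = Quat (r * qre x) (r * qi x) (r * qj x) (r * qk x)"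

instance
  by standard (auto simp: quat_ring_defs scaleR_quat_def algebra_simps)

end

definition qcnj :: "quat \<Rightarrow> quat" where
  "qcnj x = Quat (qre x) (- qi x) (- qj x) (- qk x)"

definition qnormsq :: "quat \<Rightarrow> real" where
  "qnormsq x = (qre x)\<^sup>2 + (qi x)\<^sup>2 + (qj x)\<^sup>2 + (qk x)\<^sup>2"

lemma qnormsq_eq_0_iff: "qnormsq x = 0 \<longleftrightarrow> x = 0"
  by (cases x) (simp add: qnormsq_def zero_quat_def add_nonneg_eq_0_iff)

lemma quat_mult_qcnj: "x * qcnj x = qnormsq x *\<^sub>R 1" "qcnj x * x = qnormsq x *\<^sub>R 1"
  by (simp_all add: qnormsq_def qcnj_def times_quat_def one_quat_def scaleR_quat_def
      power2_eq_square)

instantiation quat :: division_ring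
begin

definition "inverse x = inverse (qnormsq x) *\<^sub>R qcnj x"
definition "x div y = x * inverse y" for x y :: quat

instance
proof
  fix x y :: quat
  show "inverse x * x = 1" "x * inverse x = 1" if "x \<noteq> 0"
    using that by (simp_all add: inverse_quat_def quat_mult_qcnj qnormsq_eq_0_iff)
  show "x div y = x * inverse y"
    by (rule divide_quat_def)
  show "inverse (0 :: quat) = 0"
    by (simp add: inverse_quat_def zero_quat_def scaleR_quat_def qnormsq_def)
qed

end

section \<open>Conjugate transpose, rank and index\<close>

definition ctranspose :: "quat mat \<Rightarrow> quat mat" where
  "ctranspose M = map_mat qcnj (transpose_mat M)"

text \<open>Vectors are columns and scalars act on the right.\<close>

definition right_lincomb :: "nat \<Rightarrow> quat vec set \<Rightarrow> (quat vec \<Rightarrow> quat) \<Rightarrow> quat vec" where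
  "right_lincomb d B c = vec d (\<lambda>i. \<Sum>v\<in>B. v $ i * c v)"

definition right_indep :: "nat \<Rightarrow> quat vec set \<Rightarrow> bool" where
  "right_indep d B \<longleftrightarrow> (\<forall>c. right_lincomb d B c = 0\<^sub>v d \<longrightarrow> (\<forall>v\<in>B. c v = 0))"

definition right_span :: "nat \<Rightarrow> quat vec set \<Rightarrow> quat vec set" where
  "right_span d B = range (right_lincomb d B)"

definition right_basis :: "nat \<Rightarrow> quat vec set \<Rightarrow> quat vec set \<Rightarrow> bool" where
  "right_basis d S B \<longleftrightarrow>
     finite B \<and> B \<subseteq> carrier_vec d \<and> right_indep d B \<and> right_span d B = S"

definition right_dim :: "nat \<Rightarrow> quat vec set \<Rightarrow> nat" where
  "right_dim d S = card (SOME B. right_basis d S B)"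

definition right_col_space :: "quat mat \<Rightarrow> quat vec set" where
  "right_col_space M = {M *\<^sub>v x | x. x \<in> carrier_vec (dim_col M)}"

definition qrank :: "quat mat \<Rightarrow> nat" where
  "qrank M = right_dim (dim_row M) (right_col_space M)"

definition mat_index :: "quat mat \<Rightarrow> nat" where
  "mat_index M = (LEAST k. qrank (M ^\<^sub>m (k + 1)) = qrank (M ^\<^sub>m k))"

section \<open>The W-weighted Drazin inverse\<close>

definition is_wdrazin :: "quat mat \<Rightarrow> quat mat \<Rightarrow> quat mat \<Rightarrow> bool" where
  "is_wdrazin A W X \<longleftrightarrow>
     (let k = max (mat_index (A * W)) (mat_index (W * A)) in
       X \<in> carrier_mat (dim_row A) (dim_col A) \<and>
       (A * W) ^\<^sub>m (k + 1) * X * W = (A * W) ^\<^sub>m k \<and>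
       X * W * A * W * X = X \<and>
       A * W * X = X * W * A)"

definition wdrazin :: "quat mat \<Rightarrow> quat mat \<Rightarrow> quat mat" where
  "wdrazin A W = (THE X. is_wdrazin A W X)"

section \<open>Row and column determinants\<close>

text \<open>
  Indices are 0-based. The determinants carry the index set \<open>\<alpha>\<close> as an argument, so that
  \<open>rdet \<alpha> i M\<close> is the row determinant of the principal submatrix of \<open>M\<close> with rows and columns
  \<open>\<alpha>\<close>, along the row whose index in \<open>M\<close> is \<open>i \<in> \<alpha>\<close>; the full determinant of an
  \<open>N\<close> by \<open>N\<close> matrix is the case \<open>\<alpha> = {..<N}\<close>.

  \<open>support \<sigma> s\<close> is the cycle \<open>[s, \<sigma> s, \<sigma> (\<sigma> s), \<dots>]\<close> of \<open>\<sigma>\<close> through \<open>s\<close>. Its product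
  is \<open>m(s, \<sigma> s) m(\<sigma> s, \<sigma> (\<sigma> s)) \<cdots>\<close>, which starts with row index \<open>s\<close> and ends with column
  index \<open>s\<close>.
\<close>

definition cycle_prod :: "quat mat \<Rightarrow> (nat \<Rightarrow> nat) \<Rightarrow> nat \<Rightarrow> quat" where
  "cycle_prod M \<sigma> s = prod_list (map (\<lambda>x. M $$ (x, \<sigma> x)) (support \<sigma> s))"

text \<open>
  One distinguished element per cycle: first \<open>i\<close>, then the smallest elements of the cycles not
  containing \<open>i\<close>, in increasing order.
\<close>

definition cycle_starts :: "nat set \<Rightarrow> nat \<Rightarrow> (nat \<Rightarrow> nat) \<Rightarrow> nat list" where
  "cycle_starts \<alpha> i \<sigma> =
     i # sorted_list_of_set {x \<in> \<alpha>. x \<notin> set (support \<sigma> i) \<and> x = Min (set (support \<sigma> x))}"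

definition rdet :: "nat set \<Rightarrow> nat \<Rightarrow> quat mat \<Rightarrow> quat" where
  "rdet \<alpha> i M = (\<Sum>\<sigma> | \<sigma> permutes \<alpha>.
     (- 1) ^ (card \<alpha> - length (cycle_starts \<alpha> i \<sigma>)) *
     prod_list (map (cycle_prod M \<sigma>) (cycle_starts \<alpha> i \<sigma>)))"

text \<open>
  In the column determinant the cycles are written from right to left, the cycle of \<open>j\<close> being
  the last one and each cycle ending with its distinguished element. In the factors belonging to
  a cycle \<open>(j\<^sub>l \<dots> j\<^sub>1 s)\<close>, namely \<open>m(s, j\<^sub>l) \<cdots> m(j\<^sub>2, j\<^sub>1) m(j\<^sub>1, s)\<close>, each row index
  is followed by its image (\<open>\<tau> s = j\<^sub>l\<close>), so this is again the cycle product from \<open>s\<close>; only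
  the order of the cycles is reversed.
\<close>

definition cdet :: "nat set \<Rightarrow> nat \<Rightarrow> quat mat \<Rightarrow> quat" where
  "cdet \<alpha> j M = (\<Sum>\<tau> | \<tau> permutes \<alpha>.
     (- 1) ^ (card \<alpha> - length (cycle_starts \<alpha> j \<tau>)) *
     prod_list (map (cycle_prod M \<tau>) (rev (cycle_starts \<alpha> j \<tau>))))"

text \<open>The common real value of all row and column determinants; used for Hermitian
  \<open>M\<close> and nonempty \<open>\<alpha>\<close>.\<close>

definition hdet :: "nat set \<Rightarrow> quat mat \<Rightarrow> real" where
  "hdet \<alpha> M = (THE d. \<forall>i\<in>\<alpha>. rdet \<alpha> i M = of_real d \<and> cdet \<alpha> i M = of_real d)"

section \<open>Determinantal expressions\<close>

definition replace_row :: "'a mat \<Rightarrow> 'a vec \<Rightarrow> nat \<Rightarrow> 'a mat" where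
  "replace_row M b k = mat (dim_row M) (dim_col M) (\<lambda>(i, j). if i = k then b $ j else M $$ (i, j))"

definition index_sets :: "nat \<Rightarrow> nat \<Rightarrow> nat set set" where
  "index_sets r N = {\<beta>. \<beta> \<subseteq> {..<N} \<and> card \<beta> = r}"

definition index_sets_at :: "nat \<Rightarrow> nat \<Rightarrow> nat \<Rightarrow> nat set set" where
  "index_sets_at r N t = {\<beta> \<in> index_sets r N. t \<in> \<beta>}"

definition drazin_entry1 :: "nat \<Rightarrow> quat mat \<Rightarrow> nat \<Rightarrow> nat \<Rightarrow> quat" where
  "drazin_entry1 k M i j =
     (let N = dim_row M;
          r = qrank (M ^\<^sub>m k);
          P = M ^\<^sub>m (2 * k + 1);
          G = ctranspose P * P;
          b = col (ctranspose P * M ^\<^sub>m k) j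
      in (\<Sum>t<N. (M ^\<^sub>m k) $$ (i, t) *
            (\<Sum>\<beta>\<in>index_sets_at r N t. cdet \<beta> t (replace_col G b t)))
         / of_real (\<Sum>\<beta>\<in>index_sets r N. hdet \<beta> G))"

definition drazin_entry2 :: "nat \<Rightarrow> quat mat \<Rightarrow> nat \<Rightarrow> nat \<Rightarrow> quat" where
  "drazin_entry2 k M i j =
     (let N = dim_row M;
          r = qrank (M ^\<^sub>m k);
          P = M ^\<^sub>m (2 * k + 1);
          G = P * ctranspose P;
          b = row (M ^\<^sub>m k * ctranspose P) i
      in (\<Sum>s<N. (\<Sum>\<alpha>\<in>index_sets_at r N s. rdet \<alpha> s (replace_row G b s)) *
            (M ^\<^sub>m k) $$ (s, j))
         / of_real (\<Sum>\<alpha>\<in>index_sets r N. hdet \<alpha> G))"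

definition drazin_entry :: "nat \<Rightarrow> nat \<Rightarrow> quat mat \<Rightarrow> nat \<Rightarrow> nat \<Rightarrow> quat" where
  "drazin_entry l = (if l = 1 then drazin_entry1 else drazin_entry2)"

end

theory Submission
  imports Defs
begin

text \<open>
  The representation rests on three observations.

  \<^bold>\<open>Noncommutative Cramer rule.\<close> Expand a row or column determinant along the cycle through its
  distinguished index. The other cycles of a Hermitian matrix come in pairs, a cycle and its
  reversal, with conjugate products, so they contribute only through the real parts of their
  products. A real part is central and does not depend on where the cycle starts. Hence everything
  off the distinguished cycle collapses to a real number, \<open>cycle_det\<close>, and
  \<open>cdet\<^sub>t\<close> of a Hermitian matrix with column \<open>t\<close> replaced by \<open>b\<close> becomes a signed sum over
  simple paths out of \<open>t\<close>, called \<open>cramer\<close>. Multiplying by the Hermitian matrix extends the paths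
  by one step: those that close up form the determinant, all others cancel (\<open>cramer_solves\<close>).

  \<^bold>\<open>Normal equations of any rank.\<close> Let \<open>G = P\<^sup>* P\<close> with \<open>P\<close> of rank \<open>r\<close>, and let \<open>\<beta>\<close> be a set of
  \<open>r\<close> columns. If its principal minor is nonzero, these columns of \<open>P\<close> are independent, so they
  span all columns, and the Cramer solution on \<open>\<beta>\<close> solves the whole system \<open>G x = P\<^sup>* w\<close> up to the
  factor given by the minor. If the minor is zero, the Cramer solution lies in the kernel of \<open>P\<close>.
  Summing over \<open>\<beta>\<close> solves \<open>G x = d P\<^sup>* w\<close>, where \<open>d\<close> is the sum of the principal minors of order \<open>r\<close>
  (\<open>cramer_rank_solution\<close>), and \<open>d > 0\<close> because Gram minors are nonnegative and not all zero.
  The same solvability yields that \<open>P\<close> and \<open>P\<^sup>*\<close> have equal rank.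

  \<^bold>\<open>From normal equations to Drazin inverses.\<close> With \<open>P = M\<^sup>2\<^sup>k\<^sup>+\<^sup>1\<close> the first determinantal expression
  is therefore \<open>M\<^sup>k X\<close> with \<open>P\<^sup>* P X = P\<^sup>* M\<^sup>k\<close>. As \<open>k\<close> is at least the index, \<open>M\<^sup>k\<close> and \<open>P\<close> have the same
  kernel and the same range, so \<open>P X = M\<^sup>k\<close> and \<open>M\<^sup>k X\<close> is the Drazin inverse of \<open>M\<close>. The second
  expression is the conjugate transpose of the first one for \<open>M\<^sup>*\<close>, so it gives the same matrix.
  Finally, both \<open>A (U\<^sup>D)\<^sup>2\<close> and \<open>(V\<^sup>D)\<^sup>2 A\<close> are the weighted Drazin inverse (\<open>wdrazin_eq\<close>).
\<close>

section \<open>Permutations split along one cycle\<close>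

text \<open>With a point \<open>i \<notin> S\<close> put in front, such a list is read either as a cycle through \<open>i\<close>, written from
\<open>i\<close> on, or as a simple path out of \<open>i\<close>.\<close>
definition arrangements :: "'a set \<Rightarrow> 'a list set" where
  "arrangements S = {xs. set xs \<subseteq> S \<and> distinct xs}"

lemma finite_arrangements: "finite S \<Longrightarrow> finite (arrangements S)"
  unfolding arrangements_def by (rule finite_subset_distinct)

lemma support_cong:
  assumes "x \<in> T" and "\<And>y. y \<in> T \<Longrightarrow> \<sigma> y = \<tau> y \<and> \<tau> y \<in> T"
  shows "support \<sigma> x = support \<tau> x"
proof -
  have *: "(\<sigma> ^^ n) x = (\<tau> ^^ n) x \<and> (\<tau> ^^ n) x \<in> T" for n
    by (induction n) (use assms in auto)
  then have "least_power \<sigma> x = least_power \<tau> x"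
    unfolding least_power_def by simp
  with * show ?thesis by simp
qed

text \<open>Iterating the cycle rotates its list.\<close>
lemma support_eq_list:
  assumes "distinct c" and "c \<noteq> []" and "\<And>x. x \<in> set c \<Longrightarrow> \<sigma> x = cycle_of_list c x"
  shows "support \<sigma> (hd c) = c"
proof -
  have nth: "(\<sigma> ^^ n) (hd c) = c ! (n mod length c)" for n
  proof -
    have "(\<sigma> ^^ n) (hd c) = (cycle_of_list c ^^ n) (hd c) \<and> (\<sigma> ^^ n) (hd c) \<in> set c"
    proof (induction n)
      case 0
      then show ?case using assms(2) by simp
    next
      case (Suc n)
      then show ?case using assms(3) cycle_is_surj[OF assms(1)] by auto
    qed
    moreover have "(cycle_of_list c ^^ n) (hd c) = hd (map (cycle_of_list c ^^ n) c)"
      using assms(2) by (simp add: hd_map)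
    ultimately show ?thesis
      using assms(1,2) by (simp add: cyclic_rotation hd_rotate_conv_nth)
  qed
  have "least_power \<sigma> (hd c) = length c"
    unfolding least_power_def
  proof (rule Least_equality)
    show "(\<sigma> ^^ length c) (hd c) = hd c \<and> 0 < length c"
      using nth[of "length c"] assms(2) by (simp add: hd_conv_nth)
    show "length c \<le> n" if "(\<sigma> ^^ n) (hd c) = hd c \<and> 0 < n" for n
    proof (rule ccontr)
      assume "\<not> length c \<le> n"
      then have "c ! n = c ! 0"
        using that nth[of n] assms(2) by (simp add: hd_conv_nth)
      then show False
        using \<open>\<not> length c \<le> n\<close> that nth_eq_iff_index_eq[OF assms(1), of n 0] assms(2) by auto
    qed
  qed
  with nth show ?thesis
    by (intro nth_equalityI) auto
qed

text \<open>A permutation amounts to its cycle through \<open>i\<close>, read off from \<open>i\<close> on, together with a permutation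
of the remaining points. Over a noncommutative ring this replaces expansion along a row.\<close>
lemma sum_permutations_by_cycle:
  assumes fin: "finite \<alpha>" and i: "i \<in> \<alpha>"
  shows "(\<Sum>\<sigma> | \<sigma> permutes \<alpha>. F \<sigma>) =
    (\<Sum>p\<in>arrangements (\<alpha> - {i}). \<Sum>\<tau> | \<tau> permutes \<alpha> - {i} - set p.
       F (cycle_of_list (i # p) \<circ> \<tau>))"
proof -
  let ?rest = "\<lambda>p. \<alpha> - {i} - set p"
  let ?I = "SIGMA p:arrangements (\<alpha> - {i}). {\<tau>. \<tau> permutes ?rest p}"
  let ?join = "\<lambda>(p, \<tau>). cycle_of_list (i # p) \<circ> \<tau>"
  let ?split = "\<lambda>\<sigma>. (tl (support \<sigma> i),
     (\<lambda>y. if y \<in> \<alpha> - set (support \<sigma> i) then \<sigma> y else y))"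
  have split: "?split \<sigma> \<in> ?I \<and> ?join (?split \<sigma>) = \<sigma>" if "\<sigma> permutes \<alpha>" for \<sigma>
  proof -
    have perm: "permutation \<sigma>" using that fin permutation_permutes by blast
    define c where "c = support \<sigma> i"
    have lp: "least_power \<sigma> i > 0" using least_power_of_permutation(2)[OF perm] .
    define d where "d = tl c"
    from lp have c: "c = i # d" unfolding c_def d_def by (simp add: upt_conv_Cons)
    have dist: "distinct c" unfolding c_def by (rule cycle_of_permutation[OF perm])
    have "(\<sigma> ^^ n) i \<in> \<alpha>" for n
      using permutes_in_image[OF permutes_funpow[OF that]] i by blast
    then have sub: "set c \<subseteq> \<alpha>" unfolding c_def by auto
    have eq: "\<alpha> - {i} - set (d) = \<alpha> - set c" by (auto simp: c)
    have "distinct (i # d)" "set (i # d) \<subseteq> \<alpha>" using dist sub unfolding c by auto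
    then have "d \<in> arrangements (\<alpha> - {i})" unfolding arrangements_def by auto
    moreover have "(\<lambda>y. if y \<in> \<alpha> - set c then \<sigma> y else y) permutes \<alpha> - set c"
      unfolding c_def by (rule semidecomposition[OF that fin])
    moreover have "cycle_of_list (i # d) \<circ> (\<lambda>y. if y \<in> \<alpha> - set c then \<sigma> y else y) = \<sigma>"
    proof
      fix y
      show "(cycle_of_list (i # d) \<circ> (\<lambda>y. if y \<in> \<alpha> - set c then \<sigma> y else y)) y = \<sigma> y"
      proof (cases "y \<in> set c")
        case True
        then have "\<sigma> y = cycle_of_list c y"
          using cycle_restrict[OF perm, of y i] unfolding c_def[symmetric] by simp
        with True show ?thesis by (simp flip: c)
      next
        case False
        have "\<sigma> y \<notin> set c"
        proof
          assume "\<sigma> y \<in> set c"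
          moreover have "\<sigma> y \<in> set (support \<sigma> y)"
            unfolding support_set[OF perm] using rangeI[of "\<lambda>i. (\<sigma> ^^ i) y" 1] by simp
          ultimately show False
            using False disjoint_support'[OF perm, of y i] unfolding c_def by blast
        qed
        then show ?thesis
          using False id_outside_supp[of "\<sigma> y" c] id_outside_supp[of y c]
            permutes_not_in[OF that, of y] by (simp flip: c)
      qed
    qed
    ultimately show ?thesis using eq unfolding c_def[symmetric] d_def[symmetric] by auto
  qed
  have join: "?join x permutes \<alpha> \<and> ?split (?join x) = x" if x_in: "x \<in> ?I" for x
  proof -
    obtain p \<tau> where x: "x = (p, \<tau>)" and p: "p \<in> arrangements (\<alpha> - {i})"
      and \<tau>: "\<tau> permutes ?rest p" using x_in by auto
    define c where "c = i # p"
    define \<sigma> where "\<sigma> = cycle_of_list c \<circ> \<tau>"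
    have c: "distinct c" "set c \<subseteq> \<alpha>" "c \<noteq> []" "hd c = i"
      using p i unfolding c_def arrangements_def by auto
    have rest: "?rest p = \<alpha> - set c" unfolding c_def by auto
    have "\<sigma> permutes \<alpha>" unfolding \<sigma>_def
      by (rule permutes_compose[OF permutes_subset[OF \<tau>] permutes_subset[OF cycle_permutes]])
        (use c in auto)
    moreover have supp: "support \<sigma> i = c"
    proof -
      have "\<sigma> x = cycle_of_list c x" if "x \<in> set c" for x
        using that permutes_not_in[OF \<tau>, of x] rest unfolding \<sigma>_def by simp
      from support_eq_list[OF c(1,3) this] show ?thesis using c(4) by simp
    qed
    moreover have "(\<lambda>y. if y \<in> \<alpha> - set c then \<sigma> y else y) = \<tau>"
    proof
      fix y
      have "y \<in> \<alpha> - set c \<Longrightarrow> \<tau> y \<in> \<alpha> - set c"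
        using permutes_in_image[OF \<tau>] rest by auto
      then show "(if y \<in> \<alpha> - set c then \<sigma> y else y) = \<tau> y"
        using permutes_not_in[OF \<tau>, of y] rest id_outside_supp[of "\<tau> y" c]
        unfolding \<sigma>_def by auto
    qed
    moreover have "?join x = \<sigma>" unfolding x \<sigma>_def c_def by simp
    ultimately show ?thesis by (simp only: supp) (simp add: x c_def)
  qed
  have "(\<Sum>\<sigma> | \<sigma> permutes \<alpha>. F \<sigma>) = (\<Sum>x\<in>?I. F (?join x))"
    by (rule sum.reindex_bij_witness[of _ ?join ?split]) (use split join in auto)
  also have "\<dots> = (\<Sum>p\<in>arrangements (\<alpha> - {i}). \<Sum>\<tau> | \<tau> permutes ?rest p.
       F (cycle_of_list (i # p) \<circ> \<tau>))"
    by (subst sum.Sigma) (auto simp: fin finite_arrangements finite_permutations split_def)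
  finally show ?thesis .
qed

lemma support_join_first:
  assumes "p \<in> arrangements (\<alpha> - {i})" and "\<tau> permutes \<alpha> - {i} - set p"
  shows "support (cycle_of_list (i # p) \<circ> \<tau>) i = i # p"
proof -
  have "distinct (i # p)" using assms(1) unfolding arrangements_def by auto
  moreover have "(cycle_of_list (i # p) \<circ> \<tau>) x = cycle_of_list (i # p) x" if "x \<in> set (i # p)" for x
    using that permutes_not_in[OF assms(2), of x] by auto
  ultimately show ?thesis using support_eq_list[of "i # p"] by simp
qed

lemma join_eq_outside:
  assumes "\<tau> permutes \<alpha> - {i} - set p" and "x \<in> \<alpha> - {i} - set p"
  shows "(cycle_of_list (i # p) \<circ> \<tau>) x = \<tau> x \<and> \<tau> x \<in> \<alpha> - {i} - set p"
proof -
  have *: "\<tau> x \<in> \<alpha> - {i} - set p" using assms(2) permutes_in_image[OF assms(1), of x] by blast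
  then show ?thesis using id_outside_supp[of "\<tau> x" "i # p"] by auto
qed

lemma support_join_outside:
  assumes "\<tau> permutes \<alpha> - {i} - set p" and "x \<in> \<alpha> - {i} - set p"
  shows "support (cycle_of_list (i # p) \<circ> \<tau>) x = support \<tau> x"
  using assms(2) join_eq_outside[OF assms(1)] by (rule support_cong)

lemma cycle_prod_cong:
  assumes "finite \<gamma>" and "\<tau> permutes \<gamma>" and "x \<in> \<gamma>"
    and "\<And>y. y \<in> \<gamma> \<Longrightarrow> \<sigma> y = \<tau> y"
    and "\<And>y z. y \<in> \<gamma> \<Longrightarrow> z \<in> \<gamma> \<Longrightarrow> M $$ (y, z) = M' $$ (y, z)"
  shows "cycle_prod M \<sigma> x = cycle_prod M' \<tau> x"
proof -
  have im: "\<tau> y \<in> \<gamma>" if "y \<in> \<gamma>" for y using that permutes_in_image[OF assms(2), of y] by blast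
  have supp: "support \<sigma> x = support \<tau> x"
    by (rule support_cong[of _ \<gamma>]) (use assms im in auto)
  have "(\<tau> ^^ n) x \<in> \<gamma>" for n
    by (induction n) (use assms im in auto)
  then have "set (support \<tau> x) \<subseteq> \<gamma>" by auto
  then show ?thesis unfolding cycle_prod_def supp
    by (intro arg_cong[of _ _ prod_list] map_cong) (use assms im in auto)
qed

section \<open>Sums over lists without repetition\<close>

lemma sum_arrangements_pairs_swap:
  assumes "finite S"
  shows "(\<Sum>a\<in>arrangements S. \<Sum>b\<in>arrangements (S - set a). F a b) =
    (\<Sum>b\<in>arrangements S. \<Sum>a\<in>arrangements (S - set b). F a b)"
proof -
  have "(\<Sum>a\<in>arrangements S. \<Sum>b\<in>arrangements (S - set a). F a b) =
      (\<Sum>(a, b)\<in>(SIGMA a:arrangements S. arrangements (S - set a)). F a b)"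
    by (subst sum.Sigma) (use assms in \<open>auto simp: finite_arrangements\<close>)
  also have "\<dots> = (\<Sum>(b, a)\<in>(SIGMA b:arrangements S. arrangements (S - set b)). F a b)"
    by (rule sum.reindex_bij_witness[of _ "\<lambda>(a, b). (b, a)" "\<lambda>(a, b). (b, a)"])
      (auto simp: arrangements_def)
  also have "\<dots> = (\<Sum>b\<in>arrangements S. \<Sum>a\<in>arrangements (S - set b). F a b)"
    by (subst sum.Sigma) (use assms in \<open>auto simp: finite_arrangements\<close>)
  finally show ?thesis .
qed

lemma cut_at_first:
  assumes "u \<notin> set a"
  shows "takeWhile (\<lambda>x. x \<noteq> u) (a @ u # b) = a" and "dropWhile (\<lambda>x. x \<noteq> u) (a @ u # b) = u # b"
  using assms by (induction a) auto

text \<open>The list is cut at its unique entry \<open>u\<close>. For lists extending a path out of \<open>u\<close>, the part \<open>a\<close> closes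
up to a cycle through \<open>u\<close> and \<open>b\<close> is the rest of the path.\<close>
lemma sum_arrangements_split_at:
  assumes "finite S" and "u \<in> S"
  shows "(\<Sum>q | q \<in> arrangements S \<and> u \<in> set q. F q) =
    (\<Sum>b\<in>arrangements (S - {u}). \<Sum>a\<in>arrangements (S - {u} - set b). F (a @ u # b))"
proof -
  let ?I = "SIGMA b:arrangements (S - {u}). arrangements (S - {u} - set b)"
  let ?pre = "takeWhile (\<lambda>x. x \<noteq> u)" and ?post = "\<lambda>q. tl (dropWhile (\<lambda>x. x \<noteq> u) q)"
  have split: "\<exists>a b. q = a @ u # b \<and> u \<notin> set a \<and> ?pre q = a \<and> ?post q = b"
    if u_in: "u \<in> set q" for q
  proof -
    obtain a b where q: "q = a @ u # b" "u \<notin> set a" using split_list_first[OF u_in] by blast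
    then show ?thesis
      by (intro exI[of _ a] exI[of _ b]) (simp add: cut_at_first)
  qed
  have "(\<Sum>q | q \<in> arrangements S \<and> u \<in> set q. F q) = (\<Sum>(b, a)\<in>?I. F (a @ u # b))"
  proof (rule sum.reindex_bij_witness[of _ "\<lambda>(b, a). a @ u # b" "\<lambda>q. (?post q, ?pre q)"])
    fix q assume "q \<in> {q. q \<in> arrangements S \<and> u \<in> set q}"
    then have q: "q \<in> arrangements S" "u \<in> set q" by auto
    obtain a b where ab: "q = a @ u # b" "u \<notin> set a" "?pre q = a" "?post q = b"
      using split[OF q(2)] by blast
    have "set a \<subseteq> S - {u} - set b" "set b \<subseteq> S - {u}" "distinct a" "distinct b"
      using q(1) ab(2) unfolding ab(1) arrangements_def by auto
    then have "(b, a) \<in> ?I" unfolding arrangements_def by auto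
    then show "(case (?post q, ?pre q) of (b, a) \<Rightarrow> a @ u # b) = q"
      "(?post q, ?pre q) \<in> ?I"
      "(case (?post q, ?pre q) of (b, a) \<Rightarrow> F (a @ u # b)) = F q"
      unfolding ab(3,4) by (simp_all add: ab(1))
  next
    fix x assume x_in: "x \<in> ?I"
    obtain b a where x: "x = (b, a)" by (cases x)
    have ab: "set a \<subseteq> S - {u} - set b" "set b \<subseteq> S - {u}" "distinct a" "distinct b"
      using x_in unfolding x arrangements_def by auto
    then have "u \<notin> set a" by auto
    then have "?pre (a @ u # b) = a" "?post (a @ u # b) = b"
      using cut_at_first[of u a b] by auto
    then show "(?post (case x of (b, a) \<Rightarrow> a @ u # b), ?pre (case x of (b, a) \<Rightarrow> a @ u # b)) = x"
      unfolding x by simp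
    show "(case x of (b, a) \<Rightarrow> a @ u # b) \<in> {q. q \<in> arrangements S \<and> u \<in> set q}"
      using ab assms(2) unfolding x arrangements_def by auto
  qed
  also have "\<dots> = (\<Sum>b\<in>arrangements (S - {u}). \<Sum>a\<in>arrangements (S - {u} - set b). F (a @ u # b))"
    by (subst sum.Sigma) (use assms in \<open>auto simp: finite_arrangements\<close>)
  finally show ?thesis .
qed

lemma sum_arrangements_by_membership:
  assumes "finite S"
  shows "(\<Sum>q\<in>arrangements S. F q) =
    (\<Sum>q | q \<in> arrangements S \<and> u \<in> set q. F q) + (\<Sum>q\<in>arrangements (S - {u}). F q)"
proof -
  have "arrangements S = {q. q \<in> arrangements S \<and> u \<in> set q} \<union> arrangements (S - {u})"
    and "{q. q \<in> arrangements S \<and> u \<in> set q} \<inter> arrangements (S - {u}) = {}"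
    unfolding arrangements_def by auto
  then show ?thesis
    by (metis (no_types, lifting) assms finite_Un finite_arrangements sum.union_disjoint)
qed

lemma sum_arrangements_by_head:
  assumes "finite S"
  shows "(\<Sum>q\<in>arrangements S. F q) =
    F [] + (\<Sum>t\<in>S. \<Sum>p\<in>arrangements (S - {t}). F (t # p))"
proof -
  have "(\<Sum>q\<in>arrangements S - {[]}. F q) =
      (\<Sum>(t, p)\<in>(SIGMA t:S. arrangements (S - {t})). F (t # p))"
    by (rule sum.reindex_bij_witness[of _ "\<lambda>(t, p). t # p" "\<lambda>q. (hd q, tl q)"])
      (auto simp: arrangements_def neq_Nil_conv)
  also have "\<dots> = (\<Sum>t\<in>S. \<Sum>p\<in>arrangements (S - {t}). F (t # p))"
    by (subst sum.Sigma) (use assms in \<open>auto simp: finite_arrangements\<close>)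
  finally show ?thesis
    using sum.remove[OF finite_arrangements[OF assms], of "[]" F]
    by (simp add: arrangements_def)
qed

lemma sum_arrangements_rev:
  "(\<Sum>p\<in>arrangements S. F (rev p)) = (\<Sum>p\<in>arrangements S. F p)"
  by (rule sum.reindex_bij_witness[of _ rev rev]) (auto simp: arrangements_def)

section \<open>Walk products and the cycle determinant\<close>

fun walk_prod :: "('a \<Rightarrow> 'a \<Rightarrow> 'b::monoid_mult) \<Rightarrow> 'a list \<Rightarrow> 'b" where
  "walk_prod g (x # y # xs) = g x y * walk_prod g (y # xs)"
| "walk_prod g xs = 1"

lemma walk_prod_split:
  "walk_prod g (xs @ u # ys) = walk_prod g (xs @ [u]) * walk_prod g (u # ys)"
  by (induction g xs rule: walk_prod.induct) (auto simp: mult.assoc)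

lemma walk_prod_cong:
  "(\<And>x y. x \<in> set xs \<Longrightarrow> y \<in> set xs \<Longrightarrow> g x y = h x y) \<Longrightarrow> walk_prod g xs = walk_prod h xs"
  by (induction g xs rule: walk_prod.induct) auto

lemma qcnj_mult: "qcnj (x * y) = qcnj y * qcnj x"
  by (simp add: qcnj_def times_quat_def algebra_simps)

lemma qcnj_add: "qcnj (x + y) = qcnj x + qcnj y"
  by (simp add: qcnj_def plus_quat_def)

lemma qcnj_0 [simp]: "qcnj 0 = 0" and qcnj_1 [simp]: "qcnj 1 = 1"
  by (simp_all add: qcnj_def zero_quat_def one_quat_def)

lemma qcnj_qcnj [simp]: "qcnj (qcnj x) = x"
  by (simp add: qcnj_def)

lemma qcnj_scaleR: "qcnj (r *\<^sub>R x) = r *\<^sub>R qcnj x"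
  by (simp add: qcnj_def scaleR_quat_def)

lemma qcnj_sum: "qcnj (\<Sum>x\<in>A. f x) = (\<Sum>x\<in>A. qcnj (f x))"
  by (induction A rule: infinite_finite_induct) (simp_all add: qcnj_add)

lemma qre_mult_commute: "qre (x * y) = qre (y * x)"
  by (simp add: times_quat_def)

lemma add_qcnj: "x + qcnj x = (2 * qre x) *\<^sub>R 1"
  by (simp add: qcnj_def plus_quat_def one_quat_def scaleR_quat_def)

text \<open>Restricted to an index set, since the determinants are those of principal submatrices and one line
of the matrix may have been replaced.\<close>
definition hermitian_on :: "'a set \<Rightarrow> ('a \<Rightarrow> 'a \<Rightarrow> quat) \<Rightarrow> bool" where
  "hermitian_on S g \<longleftrightarrow> (\<forall>x\<in>S. \<forall>y\<in>S. g y x = qcnj (g x y))"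

lemma walk_prod_rev:
  assumes "hermitian_on S g"
  shows "set xs \<subseteq> S \<Longrightarrow> walk_prod g (rev xs) = qcnj (walk_prod g xs)"
proof (induction xs rule: induct_list012)
  case (3 x y xs)
  have "walk_prod g (rev (x # y # xs)) = walk_prod g (rev (y # xs)) * g y x"
    using walk_prod_split[of g "rev xs" y "[x]"] by simp
  also have "g y x = qcnj (g x y)"
    using 3(3) assms unfolding hermitian_on_def by (meson list.set_intros subsetD)
  also have "walk_prod g (rev (y # xs)) = qcnj (walk_prod g (y # xs))"
    using 3(2,3) by simp
  finally show ?case by (simp add: qcnj_mult)
qed auto

text \<open>This is the sum over all permutations of \<open>\<gamma>\<close> of the sign times the real parts of the cycle products,
organised by the cycle through the least element. It will be the common value of all row and
column determinants of a Hermitian matrix; it is defined through real parts so that it is real,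
and hence central, from the start.\<close>
function cycle_det :: "('a::linorder \<Rightarrow> 'a \<Rightarrow> quat) \<Rightarrow> 'a set \<Rightarrow> real" where
  "cycle_det g \<gamma> = (if finite \<gamma> \<and> \<gamma> \<noteq> {} then
     \<Sum>p\<in>arrangements (\<gamma> - {Min \<gamma>}).
       (- 1) ^ length p * qre (walk_prod g (Min \<gamma> # p @ [Min \<gamma>])) *
       cycle_det g (\<gamma> - {Min \<gamma>} - set p)
     else 1)"
  by pat_completeness auto
termination
proof (relation "measure (\<lambda>(g, \<gamma>). card \<gamma>)", goal_cases)
  case (2 g \<gamma> p)
  then have "\<gamma> - {Min \<gamma>} - set p \<subset> \<gamma>" using Min_in[of \<gamma>] by blast
  then show ?case using 2 by (simp add: psubset_card_mono)
qed simp

declare cycle_det.simps [simp del]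

lemma cycle_det_empty [simp]: "cycle_det g {} = 1"
  by (simp add: cycle_det.simps)

text \<open>The starting point does not matter. Compare \<open>u\<close> and \<open>v\<close>: a cycle through both may be rotated,
because \<open>qre (x * y) = qre (y * x)\<close>; if the cycle through \<open>u\<close> avoids \<open>v\<close>, then by induction the
cycle through \<open>v\<close> can be split off next, and the order of splitting off two disjoint cycles is
immaterial.\<close>
lemma cycle_det_expand:
  assumes "finite \<gamma>" and "u \<in> \<gamma>"
  shows "cycle_det g \<gamma> = (\<Sum>p\<in>arrangements (\<gamma> - {u}).
    (- 1) ^ length p * qre (walk_prod g (u # p @ [u])) * cycle_det g (\<gamma> - {u} - set p))"
  using assms
proof (induction "card \<gamma>" arbitrary: \<gamma> u rule: less_induct)
  case less
  let ?R = "\<lambda>u p. (- 1) ^ length p * qre (walk_prod g (u # p @ [u]))"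
  let ?T = "\<lambda>u p. ?R u p * cycle_det g (\<gamma> - {u} - set p)"
  note fin = \<open>finite \<gamma>\<close>
  have swap: "(\<Sum>p\<in>arrangements (\<gamma> - {u}). ?T u p) = (\<Sum>p\<in>arrangements (\<gamma> - {v}). ?T v p)"
    if u: "u \<in> \<gamma>" and v: "v \<in> \<gamma>" and "u \<noteq> v" for u v
  proof -
    define S where "S = \<gamma> - {u} - {v}"
    have S: "finite S" "\<gamma> - {v} - {u} = S" "\<gamma> - {u} - {v} = S" unfolding S_def using fin by auto
    have sum_u: "(\<Sum>p\<in>arrangements (\<gamma> - {u}). ?T u p) =
        (\<Sum>b\<in>arrangements S. \<Sum>a\<in>arrangements (S - set b). ?T u (a @ v # b)) +
        (\<Sum>p\<in>arrangements S. ?T u p)"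
      using sum_arrangements_by_membership[of "\<gamma> - {u}" "?T u" v]
        sum_arrangements_split_at[of "\<gamma> - {u}" v "?T u"] fin v \<open>u \<noteq> v\<close> by (simp add: S)
    have sum_v: "(\<Sum>p\<in>arrangements (\<gamma> - {v}). ?T v p) =
        (\<Sum>b\<in>arrangements S. \<Sum>a\<in>arrangements (S - set b). ?T v (a @ u # b)) +
        (\<Sum>p\<in>arrangements S. ?T v p)"
      using sum_arrangements_by_membership[of "\<gamma> - {v}" "?T v" u]
        sum_arrangements_split_at[of "\<gamma> - {v}" u "?T v"] fin u \<open>u \<noteq> v\<close> by (simp add: S)
    have "?T u (a @ v # b) = ?T v (b @ u # a)" for a b
    proof -
      have "walk_prod g (u # (a @ v # b) @ [u]) = walk_prod g (u # a @ [v]) * walk_prod g (v # b @ [u])"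
        using walk_prod_split[of g "u # a" v "b @ [u]"] by simp
      moreover have "walk_prod g (v # (b @ u # a) @ [v]) = walk_prod g (v # b @ [u]) * walk_prod g (u # a @ [v])"
        using walk_prod_split[of g "v # b" u "a @ [v]"] by simp
      moreover have "\<gamma> - {u} - set (a @ v # b) = \<gamma> - {v} - set (b @ u # a)" by auto
      ultimately show ?thesis by (simp add: qre_mult_commute add.commute)
    qed
    then have both: "(\<Sum>b\<in>arrangements S. \<Sum>a\<in>arrangements (S - set b). ?T u (a @ v # b)) =
        (\<Sum>b\<in>arrangements S. \<Sum>a\<in>arrangements (S - set b). ?T v (a @ u # b))"
      using sum_arrangements_pairs_swap[OF S(1), of "\<lambda>a b. ?T v (b @ u # a)"] by simp
    have one: "(\<Sum>p\<in>arrangements S. ?T u p) = (\<Sum>p\<in>arrangements S.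
        \<Sum>q\<in>arrangements (S - set p). ?R u p * ?R v q * cycle_det g (S - set p - set q))"
      if "S = \<gamma> - {u} - {v}" and u: "u \<in> \<gamma>" and v: "v \<in> \<gamma>" and "u \<noteq> v" for u v
    proof (rule sum.cong)
      fix p assume "p \<in> arrangements S"
      then have "v \<in> \<gamma> - {u} - set p" using that unfolding arrangements_def by auto
      moreover have "\<gamma> - {u} - set p \<subset> \<gamma>" using u by auto
      ultimately have "cycle_det g (\<gamma> - {u} - set p) = (\<Sum>q\<in>arrangements (\<gamma> - {u} - set p - {v}).
          ?R v q * cycle_det g (\<gamma> - {u} - set p - {v} - set q))"
        using less(1)[of "\<gamma> - {u} - set p" v] fin by (simp add: psubset_card_mono)
      moreover have "\<gamma> - {u} - set p - {v} = S - set p" using that by auto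
      ultimately show "?T u p =
          (\<Sum>q\<in>arrangements (S - set p). ?R u p * ?R v q * cycle_det g (S - set p - set q))"
        by (simp add: sum_distrib_left mult.assoc)
    qed simp
    have "(\<Sum>p\<in>arrangements S. ?T u p) = (\<Sum>p\<in>arrangements S. ?T v p)"
    proof -
      have "(\<Sum>p\<in>arrangements S. ?T v p) = (\<Sum>p\<in>arrangements S.
        \<Sum>q\<in>arrangements (S - set p). ?R v p * ?R u q * cycle_det g (S - set p - set q))"
        by (rule one) (use that S in auto)
      also have "\<dots> = (\<Sum>p\<in>arrangements S.
        \<Sum>q\<in>arrangements (S - set p). ?R u p * ?R v q * cycle_det g (S - set p - set q))"
        by (subst sum_arrangements_pairs_swap[OF S(1)])
          (auto intro!: sum.cong arg_cong[of _ _ "cycle_det g"])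
      also have "\<dots> = (\<Sum>p\<in>arrangements S. ?T u p)"
        by (rule one[symmetric]) (use that S in auto)
      finally show ?thesis ..
    qed
    with both show ?thesis unfolding sum_u sum_v by simp
  qed
  have min: "Min \<gamma> \<in> \<gamma>" using less.prems Min_in by blast
  have "cycle_det g \<gamma> = (\<Sum>p\<in>arrangements (\<gamma> - {Min \<gamma>}). ?T (Min \<gamma>) p)"
    using less by (subst cycle_det.simps) auto
  also have "\<dots> = (\<Sum>p\<in>arrangements (\<gamma> - {u}). ?T u p)"
    using swap[OF min \<open>u \<in> \<gamma>\<close>] by (cases "Min \<gamma> = u") auto
  finally show ?case .
qed

lemma hermitian_on_subset: "hermitian_on S g \<Longrightarrow> T \<subseteq> S \<Longrightarrow> hermitian_on T g"
  unfolding hermitian_on_def by blast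

text \<open>Reversing a cycle conjugates its product, so in the sum over all cycles through \<open>u\<close> the products
may be replaced by their real parts.\<close>
lemma cycle_det_expand_hermitian:
  assumes "finite \<gamma>" and "u \<in> \<gamma>" and herm: "hermitian_on \<gamma> g"
  shows "(\<Sum>p\<in>arrangements (\<gamma> - {u}).
      ((- 1) ^ length p * cycle_det g (\<gamma> - {u} - set p)) *\<^sub>R walk_prod g (u # p @ [u])) =
    cycle_det g \<gamma> *\<^sub>R 1"
proof -
  let ?c = "\<lambda>p. (- 1) ^ length p * cycle_det g (\<gamma> - {u} - set p)"
  let ?S = "\<Sum>p\<in>arrangements (\<gamma> - {u}). ?c p *\<^sub>R walk_prod g (u # p @ [u])"
  have "?S + ?S = ?S + (\<Sum>p\<in>arrangements (\<gamma> - {u}). ?c (rev p) *\<^sub>R walk_prod g (u # rev p @ [u]))"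
    by (subst (4) sum_arrangements_rev[symmetric]) simp
  also have "\<dots> = ?S + (\<Sum>p\<in>arrangements (\<gamma> - {u}). ?c p *\<^sub>R qcnj (walk_prod g (u # p @ [u])))"
  proof -
    have "walk_prod g (u # rev p @ [u]) = qcnj (walk_prod g (u # p @ [u]))"
      if "p \<in> arrangements (\<gamma> - {u})" for p
      using walk_prod_rev[OF herm, of "u # p @ [u]"] that assms(2)
      unfolding arrangements_def by auto
    then show ?thesis by (simp cong: sum.cong)
  qed
  also have "\<dots> = (\<Sum>p\<in>arrangements (\<gamma> - {u}). ?c p *\<^sub>R (2 * qre (walk_prod g (u # p @ [u]))) *\<^sub>R 1)"
    by (simp only: sum.distrib[symmetric] scaleR_add_right[symmetric] add_qcnj)
  also have "\<dots> = (2 * (\<Sum>p\<in>arrangements (\<gamma> - {u}). 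
      (- 1) ^ length p * qre (walk_prod g (u # p @ [u])) * cycle_det g (\<gamma> - {u} - set p))) *\<^sub>R 1"
    unfolding sum_distrib_left scaleR_sum_left
    by (intro sum.cong refl) (simp add: mult_ac)
  also have "\<dots> = (2 * cycle_det g \<gamma>) *\<^sub>R 1"
    using cycle_det_expand[OF assms(1,2), of g] by simp
  finally have "2 *\<^sub>R ?S = 2 *\<^sub>R (cycle_det g \<gamma> *\<^sub>R 1)"
    by (simp add: scaleR_2)
  then show ?thesis by (simp only: scaleR_cancel_left) simp
qed

section \<open>Cramer's rule\<close>

text \<open>The path expansion of the column determinant along \<open>t\<close> of \<open>g\<close> with column \<open>t\<close> replaced by \<open>b\<close>:
the cycle through \<open>t\<close> follows \<open>g\<close> along a path \<open>t # p\<close> and returns to \<open>t\<close> through an entry of \<open>b\<close>.\<close>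
definition cramer :: "('a::linorder \<Rightarrow> 'a \<Rightarrow> quat) \<Rightarrow> 'a set \<Rightarrow> 'a \<Rightarrow> ('a \<Rightarrow> quat) \<Rightarrow> quat" where
  "cramer g \<beta> t b = (\<Sum>p\<in>arrangements (\<beta> - {t}).
     ((- 1) ^ length p * cycle_det g (\<beta> - {t} - set p)) *\<^sub>R
       (walk_prod g (t # p) * b (last (t # p))))"

text \<open>Multiplication by \<open>g u t\<close> puts \<open>u\<close> in front of the paths, so the left-hand side sums over all
nonempty lists \<open>q\<close> in \<open>\<beta>\<close>, weighted by the walk \<open>u # q\<close>. If \<open>q = a @ u # r\<close>, the part
\<open>u # a @ [u]\<close> is a cycle; summing over \<open>a\<close> completes the determinant of \<open>\<beta> - set r\<close> and
leaves the term of the path \<open>u # r\<close>, with the opposite sign. These terms cancel against those of the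
lists avoiding \<open>u\<close>, except for \<open>r = []\<close>, which is the right-hand side.\<close>
theorem cramer_solves:
  assumes fin: "finite \<beta>" and u: "u \<in> \<beta>" and herm: "hermitian_on \<beta> g"
  shows "(\<Sum>t\<in>\<beta>. g u t * cramer g \<beta> t b) = cycle_det g \<beta> *\<^sub>R b u"
proof -
  \<comment> \<open>The empty list is included: its term is the right-hand side, so the claim becomes that all of these terms add up to 0.\<close>
  define H where "H q = ((- 1) ^ length q * cycle_det g (\<beta> - set q)) *\<^sub>R
    (walk_prod g (u # q) * b (last (u # q)))" for q
  have "(\<Sum>q\<in>arrangements \<beta>. H q) = 0"
  proof -
    have "(\<Sum>q | q \<in> arrangements \<beta> \<and> u \<in> set q. H q) =
        (\<Sum>r\<in>arrangements (\<beta> - {u}). \<Sum>a\<in>arrangements (\<beta> - {u} - set r). H (a @ u # r))"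
      by (rule sum_arrangements_split_at[OF fin u])
    also have "\<dots> = (\<Sum>r\<in>arrangements (\<beta> - {u}). - H r)"
    proof (rule sum.cong)
      fix r assume "r \<in> arrangements (\<beta> - {u})"
      then have r: "u \<in> \<beta> - set r" using u unfolding arrangements_def by auto
      define w where "w = walk_prod g (u # r) * b (last (u # r))"
      have "H (a @ u # r) = - ((- 1) ^ length r) *\<^sub>R
          (((- 1) ^ length a * cycle_det g (\<beta> - set r - {u} - set a)) *\<^sub>R
            walk_prod g (u # a @ [u]) * w)" for a
      proof -
        have *: "\<beta> - set (a @ u # r) = \<beta> - set r - {u} - set a" by auto
        show ?thesis unfolding H_def * w_def
          using walk_prod_split[of g "u # a" u r] by (simp add: power_add mult.assoc mult_ac)
      qed
      moreover have "\<beta> - {u} - set r = \<beta> - set r - {u}" by auto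
      ultimately have "(\<Sum>a\<in>arrangements (\<beta> - {u} - set r). H (a @ u # r)) =
          - ((- 1) ^ length r) *\<^sub>R ((\<Sum>a\<in>arrangements (\<beta> - set r - {u}).
            ((- 1) ^ length a * cycle_det g (\<beta> - set r - {u} - set a)) *\<^sub>R
              walk_prod g (u # a @ [u])) * w)"
        by (simp only: sum_distrib_right scaleR_sum_right)
      also have "\<dots> = - ((- 1) ^ length r) *\<^sub>R ((cycle_det g (\<beta> - set r) *\<^sub>R 1) * w)"
        by (subst cycle_det_expand_hermitian[OF _ r hermitian_on_subset[OF herm]]) (use fin in auto)
      also have "\<dots> = - H r" unfolding H_def w_def by simp
      finally show "(\<Sum>a\<in>arrangements (\<beta> - {u} - set r). H (a @ u # r)) = - H r" .
    qed simp
    finally show ?thesis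
      unfolding sum_arrangements_by_membership[OF fin, of H u] sum_negf by simp
  qed
  then have "H [] + (\<Sum>t\<in>\<beta>. \<Sum>p\<in>arrangements (\<beta> - {t}). H (t # p)) = 0"
    using sum_arrangements_by_head[OF fin, of H] by simp
  moreover have "H (t # p) = - (g u t * (((- 1) ^ length p * cycle_det g (\<beta> - {t} - set p)) *\<^sub>R
       (walk_prod g (t # p) * b (last (t # p)))))" for t p
  proof -
    have "\<beta> - set (t # p) = \<beta> - {t} - set p" by auto
    then show ?thesis unfolding H_def by (simp add: mult.assoc)
  qed
  moreover have "H [] = cycle_det g \<beta> *\<^sub>R b u" unfolding H_def by simp
  ultimately show ?thesis
    unfolding cramer_def by (simp add: sum_negf sum_distrib_left)
qed

lemma cramer_unit:
  assumes "finite \<beta>" and "s \<in> \<beta>"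
  shows "cramer g \<beta> s (\<lambda>x. if x = s then 1 else 0) = cycle_det g (\<beta> - {s}) *\<^sub>R 1"
proof -
  have "cramer g \<beta> s (\<lambda>x. if x = s then 1 else 0) =
      (\<Sum>p\<in>arrangements (\<beta> - {s}). if p = [] then cycle_det g (\<beta> - {s}) *\<^sub>R 1 else 0)"
    unfolding cramer_def
  proof (rule sum.cong)
    fix p assume p: "p \<in> arrangements (\<beta> - {s})"
    then have "p \<noteq> [] \<Longrightarrow> last p \<noteq> s" unfolding arrangements_def using last_in_set by fastforce
    then show "((- 1) ^ length p * cycle_det g (\<beta> - {s} - set p)) *\<^sub>R
        (walk_prod g (s # p) * (if last (s # p) = s then 1 else 0)) =
        (if p = [] then cycle_det g (\<beta> - {s}) *\<^sub>R 1 else 0)" by auto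
  qed simp
  also have "\<dots> = cycle_det g (\<beta> - {s}) *\<^sub>R 1"
    using assms by (subst sum.delta) (auto simp: finite_arrangements, simp add: arrangements_def)
  finally show ?thesis .
qed

section \<open>Row and column determinants\<close>

text \<open>Both determinants at once: the list transformation \<open>h\<close> is the identity for
  \<open>rdet\<close> and reversal for \<open>cdet\<close>.\<close>
definition line_det :: "(quat list \<Rightarrow> quat list) \<Rightarrow> nat set \<Rightarrow> nat \<Rightarrow> quat mat \<Rightarrow> quat" where
  "line_det h \<alpha> i M = (\<Sum>\<sigma> | \<sigma> permutes \<alpha>.
     (- 1) ^ (card \<alpha> - length (cycle_starts \<alpha> i \<sigma>)) *
     prod_list (h (map (cycle_prod M \<sigma>) (cycle_starts \<alpha> i \<sigma>))))"

lemma rdet_eq_line_det: "rdet \<alpha> i M = line_det id \<alpha> i M"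
  and cdet_eq_line_det: "cdet \<alpha> i M = line_det rev \<alpha> i M"
  unfolding rdet_def cdet_def line_det_def by (simp_all add: rev_map)

abbreviation (input) entry :: "'a mat \<Rightarrow> nat \<Rightarrow> nat \<Rightarrow> 'a" where
  "entry M \<equiv> \<lambda>x y. M $$ (x, y)"

definition cycle_minima :: "nat set \<Rightarrow> (nat \<Rightarrow> nat) \<Rightarrow> nat list" where
  "cycle_minima \<gamma> \<tau> = sorted_list_of_set {x \<in> \<gamma>. x = Min (set (support \<tau> x))}"

text \<open>The sum left over when the distinguished cycle is split off from \<open>line_det\<close>: every cycle now starts
at its smallest element.\<close>
definition free_det :: "(quat list \<Rightarrow> quat list) \<Rightarrow> nat set \<Rightarrow> quat mat \<Rightarrow> quat" where
  "free_det h \<gamma> M = (\<Sum>\<tau> | \<tau> permutes \<gamma>. (- 1) ^ (card \<gamma> - length (cycle_minima \<gamma> \<tau>)) *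
     prod_list (h (map (cycle_prod M \<tau>) (cycle_minima \<gamma> \<tau>))))"

lemma free_det_empty: "h [] = [] \<Longrightarrow> free_det h {} M = 1"
  unfolding free_det_def cycle_minima_def by simp

text \<open>On a nonempty set the first cycle in increasing order of the smallest elements is the one through
the minimum, so the expansion along a distinguished cycle applies again.\<close>
lemma free_det_eq_line_det:
  assumes fin: "finite \<gamma>" and "\<gamma> \<noteq> {}"
  shows "free_det h \<gamma> M = line_det h \<gamma> (Min \<gamma>) M"
proof -
  have "cycle_minima \<gamma> \<tau> = cycle_starts \<gamma> (Min \<gamma>) \<tau>" if \<tau>: "\<tau> permutes \<gamma>" for \<tau>
  proof -
    define m where "m = Min \<gamma>"
    define C where "C = {x \<in> \<gamma>. x = Min (set (support \<tau> x))}"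
    have perm: "permutation \<tau>" using \<tau> fin permutation_permutes by blast
    have m: "m \<in> \<gamma>" unfolding m_def using assms by simp
    have mem: "x \<in> set (support \<tau> x)" for x
      unfolding support_set[OF perm] using rangeI[of "\<lambda>i. (\<tau> ^^ i) x" 0] by simp
    have sub: "set (support \<tau> x) \<subseteq> \<gamma>" if "x \<in> \<gamma>" for x
      using that permutes_in_image[OF permutes_funpow[OF \<tau>]] by auto
    have same: "set (support \<tau> x) = set (support \<tau> m)" if "x \<in> set (support \<tau> m)" for x
      using disjoint_support[OF perm] that mem[of x] unfolding disjoint_def by blast
    have min_m: "Min (set (support \<tau> m)) = m"
      using mem[of m] sub[OF m] fin unfolding m_def
      by (intro Min_eqI) auto
    have "C - {m} = {x \<in> \<gamma>. x \<notin> set (support \<tau> m) \<and> x = Min (set (support \<tau> x))}"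
    proof -
      have "x = m" if "x \<in> set (support \<tau> m)" "x = Min (set (support \<tau> x))" for x
        using that(2) unfolding same[OF that(1)] min_m .
      then show ?thesis unfolding C_def using mem[of m] by blast
    qed
    moreover have "m \<in> C" unfolding C_def using m min_m by simp
    moreover have "Min C = m" using \<open>m \<in> C\<close> fin
      by (intro Min_eqI) (auto simp: C_def m_def)
    ultimately show ?thesis
      unfolding cycle_minima_def cycle_starts_def C_def[symmetric] m_def[symmetric]
      using sorted_list_of_set_nonempty[of C] fin C_def by auto
  qed
  then show ?thesis unfolding free_det_def line_det_def by (intro sum.cong) auto
qed

lemma prod_list_along_walk:
  "map \<sigma> xs = tl (xs @ [e]) \<Longrightarrow> xs \<noteq> [] \<Longrightarrow>
    prod_list (map (\<lambda>x. M $$ (x, \<sigma> x)) xs) = walk_prod (entry M) (xs @ [e])"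
proof (induction xs rule: induct_list012)
  case (3 x y xs)
  then have "\<sigma> x = y" "map \<sigma> (y # xs) = tl ((y # xs) @ [e])" by auto
  with 3(2) show ?case by simp
qed auto

text \<open>The sign of a permutation of \<open>\<beta>\<close> is that of its restriction to the complement of the first cycle,
times \<open>(- 1) ^ length p\<close> for that cycle of length \<open>length p + 1\<close>.\<close>
lemma line_det_by_first_cycle:
  assumes fin: "finite \<beta>" and t: "t \<in> \<beta>"
  shows "line_det h \<beta> t M = (\<Sum>p\<in>arrangements (\<beta> - {t}). \<Sum>\<tau> | \<tau> permutes \<beta> - {t} - set p.
    (- 1) ^ length p * ((- 1) ^ (card (\<beta> - {t} - set p) - length (cycle_minima (\<beta> - {t} - set p) \<tau>)) *
    prod_list (h (walk_prod (entry M) (t # p @ [t]) #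
      map (cycle_prod M \<tau>) (cycle_minima (\<beta> - {t} - set p) \<tau>)))))"
  unfolding line_det_def sum_permutations_by_cycle[OF fin t]
proof (intro sum.cong refl)
  fix p \<tau> assume p: "p \<in> arrangements (\<beta> - {t})" and "\<tau> \<in> {\<tau>. \<tau> permutes \<beta> - {t} - set p}"
  then have \<tau>: "\<tau> permutes \<beta> - {t} - set p" by simp
  define \<gamma> where "\<gamma> = \<beta> - {t} - set p"
  define \<sigma> where "\<sigma> = cycle_of_list (t # p) \<circ> \<tau>"
  have supp_t: "support \<sigma> t = t # p" unfolding \<sigma>_def by (rule support_join_first[OF p \<tau>])
  have supp: "support \<sigma> x = support \<tau> x" if "x \<in> \<gamma>" for x
    unfolding \<sigma>_def by (rule support_join_outside[OF \<tau>]) (use that \<gamma>_def in simp)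
  have "{x \<in> \<beta>. x \<notin> set (support \<sigma> t) \<and> x = Min (set (support \<sigma> x))} =
      {x \<in> \<gamma>. x = Min (set (support \<sigma> x))}"
    unfolding supp_t \<gamma>_def by auto
  also have "\<dots> = {x \<in> \<gamma>. x = Min (set (support \<tau> x))}"
    using supp by (intro Collect_cong conj_cong) simp_all
  finally have starts: "cycle_starts \<beta> t \<sigma> = t # cycle_minima \<gamma> \<tau>"
    unfolding cycle_starts_def cycle_minima_def by simp
  have dist: "distinct (t # p)" and sub: "set (t # p) \<subseteq> \<beta>"
    using p t unfolding arrangements_def by auto
  have fin\<gamma>: "finite \<gamma>" unfolding \<gamma>_def using fin by simp
  have "\<gamma> = \<beta> - set (t # p)" unfolding \<gamma>_def by auto
  then have "card \<gamma> = card \<beta> - card (set (t # p))"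
    using card_Diff_subset[OF _ sub] by simp
  moreover have "card (set (t # p)) \<le> card \<beta>" by (rule card_mono[OF fin sub])
  ultimately have card: "card \<beta> = Suc (length p) + card \<gamma>"
    using distinct_card[OF dist] by simp
  have le: "length (cycle_minima \<gamma> \<tau>) \<le> card \<gamma>"
    unfolding cycle_minima_def using fin\<gamma> by (auto intro!: card_mono)
  have "map \<sigma> (t # p) = map (cycle_of_list (t # p)) (t # p)"
    unfolding \<sigma>_def using permutes_not_in[OF \<tau>] by auto
  also have "\<dots> = tl ((t # p) @ [t])"
    using cyclic_rotation[OF dist, of 1] by simp
  finally have first: "cycle_prod M \<sigma> t = walk_prod (entry M) (t # p @ [t])"
    unfolding cycle_prod_def supp_t using prod_list_along_walk[of \<sigma> "t # p" t M] by simp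
  have rest: "map (cycle_prod M \<sigma>) (cycle_minima \<gamma> \<tau>) = map (cycle_prod M \<tau>) (cycle_minima \<gamma> \<tau>)"
  proof (rule map_cong)
    fix x assume "x \<in> set (cycle_minima \<gamma> \<tau>)"
    then have "x \<in> \<gamma>" unfolding cycle_minima_def using fin\<gamma> by auto
    then show "cycle_prod M \<sigma> x = cycle_prod M \<tau> x"
      by (intro cycle_prod_cong[OF fin\<gamma>])
        (use \<tau> join_eq_outside[OF \<tau>] in \<open>auto simp: \<sigma>_def \<gamma>_def\<close>)
  qed simp
  have sign: "Suc (length p) + card \<gamma> - length (t # cycle_minima \<gamma> \<tau>) =
      length p + (card \<gamma> - length (cycle_minima \<gamma> \<tau>))" using le by simp
  show "(- 1) ^ (card \<beta> - length (cycle_starts \<beta> t \<sigma>)) *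
      prod_list (h (map (cycle_prod M \<sigma>) (cycle_starts \<beta> t \<sigma>))) =
    (- 1) ^ length p * ((- 1) ^ (card \<gamma> - length (cycle_minima \<gamma> \<tau>)) *
    prod_list (h (walk_prod (entry M) (t # p @ [t]) # map (cycle_prod M \<tau>) (cycle_minima \<gamma> \<tau>))))"
    unfolding starts card sign list.map first rest power_add mult.assoc ..
qed

lemma line_det_by_walks:
  assumes fin: "finite \<beta>" and t: "t \<in> \<beta>" and h: "h = id \<or> h = rev"
  shows "line_det h \<beta> t M = (\<Sum>p\<in>arrangements (\<beta> - {t}). (- 1) ^ length p *
     (if h = id then walk_prod (entry M) (t # p @ [t]) * free_det h (\<beta> - {t} - set p) M
      else free_det h (\<beta> - {t} - set p) M * walk_prod (entry M) (t # p @ [t])))"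
proof -
  have comm: "(- 1) ^ k * x = x * (- 1) ^ k" for k and x :: quat
    by (induction k) (auto simp: mult.assoc)
  show ?thesis
    unfolding line_det_by_first_cycle[OF fin t]
  proof (rule sum.cong)
    fix p
    let ?\<gamma> = "\<beta> - {t} - set p"
    show "(\<Sum>\<tau> | \<tau> permutes ?\<gamma>. (- 1) ^ length p *
        ((- 1) ^ (card ?\<gamma> - length (cycle_minima ?\<gamma> \<tau>)) *
         prod_list (h (walk_prod (entry M) (t # p @ [t]) # map (cycle_prod M \<tau>) (cycle_minima ?\<gamma> \<tau>))))) =
      (- 1) ^ length p *
        (if h = id then walk_prod (entry M) (t # p @ [t]) * free_det h ?\<gamma> M
         else free_det h ?\<gamma> M * walk_prod (entry M) (t # p @ [t]))"
    proof (cases "h = id")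
      case True
      have "(- 1) ^ k * (x * y) = x * ((- 1) ^ k * y)" for k and x y :: quat
        by (metis comm mult.assoc)
      from this[of _ "walk_prod (entry M) (t # p @ [t])"] show ?thesis
        unfolding True free_det_def by (simp add: sum_distrib_left)
    next
      case False
      with h have "h = rev" by simp
      with False have neq: "(rev :: quat list \<Rightarrow> quat list) \<noteq> id" by simp
      show ?thesis unfolding free_det_def \<open>h = rev\<close> if_not_P[OF neq]
        by (simp add: sum_distrib_left sum_distrib_right mult.assoc)
    qed
  qed simp
qed

lemma sign_mult_eq_scaleR: "(- 1) ^ k * x = (- 1) ^ k *\<^sub>R x" for x :: quat
  by (induction k) simp_all

text \<open>By induction the factor contributed by the remaining cycles is real, so it commutes with the first
cycle product; it makes no difference on which side \<open>h\<close> places it.\<close>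
theorem free_det_hermitian:
  assumes "finite \<gamma>" and "hermitian_on \<gamma> g" and "h = id \<or> h = rev"
    and "\<And>x y. x \<in> \<gamma> \<Longrightarrow> y \<in> \<gamma> \<Longrightarrow> M $$ (x, y) = g x y"
  shows "free_det h \<gamma> M = cycle_det g \<gamma> *\<^sub>R 1"
  using assms
proof (induction "card \<gamma>" arbitrary: \<gamma> rule: less_induct)
  case less
  show ?case
  proof (cases "\<gamma> = {}")
    case True
    then show ?thesis using less(4) by (auto simp: free_det_empty)
  next
    case False
    define m where "m = Min \<gamma>"
    have m: "m \<in> \<gamma>" unfolding m_def using False less by simp
    have rest: "free_det h (\<gamma> - {m} - set p) M = cycle_det g (\<gamma> - {m} - set p) *\<^sub>R 1" for p
    proof (rule less(1))
      have "\<gamma> - {m} - set p \<subset> \<gamma>" using m by auto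
      then show "card (\<gamma> - {m} - set p) < card \<gamma>" using less by (simp add: psubset_card_mono)
      show "hermitian_on (\<gamma> - {m} - set p) g" by (rule hermitian_on_subset[OF less(3)]) auto
    qed (use less in auto)
    have "free_det h \<gamma> M = line_det h \<gamma> m M"
      unfolding m_def by (rule free_det_eq_line_det) (use less False in auto)
    also have "\<dots> = (\<Sum>p\<in>arrangements (\<gamma> - {m}).
        ((- 1) ^ length p * cycle_det g (\<gamma> - {m} - set p)) *\<^sub>R walk_prod g (m # p @ [m]))"
      unfolding line_det_by_walks[OF less(2) m less(4)]
    proof (rule sum.cong)
      fix p assume "p \<in> arrangements (\<gamma> - {m})"
      then have "walk_prod (entry M) (m # p @ [m]) = walk_prod g (m # p @ [m])"
        by (intro walk_prod_cong less(5)) (use m in \<open>auto simp: arrangements_def\<close>)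
      then show "(- 1) ^ length p *
          (if h = id then walk_prod (entry M) (m # p @ [m]) * free_det h (\<gamma> - {m} - set p) M
           else free_det h (\<gamma> - {m} - set p) M * walk_prod (entry M) (m # p @ [m])) =
          ((- 1) ^ length p * cycle_det g (\<gamma> - {m} - set p)) *\<^sub>R walk_prod g (m # p @ [m])"
        by (simp only: rest) (simp add: sign_mult_eq_scaleR mult.commute)
    qed simp
    also have "\<dots> = cycle_det g \<gamma> *\<^sub>R 1"
      by (rule cycle_det_expand_hermitian[OF less(2) m less(3)])
    finally show ?thesis .
  qed
qed

text \<open>Row \<open>t\<close> and column \<open>t\<close> are met by the first cycle only. Hence the matrix need be Hermitian only
off these two lines, and the formula covers a replaced row or column.\<close>
theorem line_det_hermitian_off_line:
  assumes fin: "finite \<beta>" and t: "t \<in> \<beta>" and h: "h = id \<or> h = rev"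
    and herm: "hermitian_on (\<beta> - {t}) g"
    and M: "\<And>x y. x \<in> \<beta> - {t} \<Longrightarrow> y \<in> \<beta> - {t} \<Longrightarrow> M $$ (x, y) = g x y"
  shows "line_det h \<beta> t M = (\<Sum>p\<in>arrangements (\<beta> - {t}).
    ((- 1) ^ length p * cycle_det g (\<beta> - {t} - set p)) *\<^sub>R walk_prod (entry M) (t # p @ [t]))"
  unfolding line_det_by_walks[OF fin t h]
proof (rule sum.cong)
  fix p
  have "free_det h (\<beta> - {t} - set p) M = cycle_det g (\<beta> - {t} - set p) *\<^sub>R 1"
    by (rule free_det_hermitian) (use fin M h hermitian_on_subset[OF herm] in auto)
  note * = this
  show "(- 1) ^ length p *
      (if h = id then walk_prod (entry M) (t # p @ [t]) * free_det h (\<beta> - {t} - set p) M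
       else free_det h (\<beta> - {t} - set p) M * walk_prod (entry M) (t # p @ [t])) =
      ((- 1) ^ length p * cycle_det g (\<beta> - {t} - set p)) *\<^sub>R walk_prod (entry M) (t # p @ [t])"
    by (simp only: *) (simp add: sign_mult_eq_scaleR mult.commute)
qed simp

section \<open>Linear independence over the quaternions\<close>

text \<open>One step of Gaussian elimination removes an equation together with an unknown; coefficients stand on
the left of the unknowns throughout.\<close>
lemma homogeneous_system_nontrivial:
  fixes a :: "'a \<Rightarrow> 'b \<Rightarrow> 'q::division_ring"
  assumes "finite R" and "finite C" and "card R < card C"
  shows "\<exists>x. (\<exists>c\<in>C. x c \<noteq> 0) \<and> (\<forall>r\<in>R. (\<Sum>c\<in>C. a r c * x c) = 0)"
  using assms
proof (induction R arbitrary: a C rule: finite_induct)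
  case empty
  then obtain c where "c \<in> C" by fastforce
  then show ?case by (intro exI[of _ "\<lambda>_. 1"]) auto
next
  case (insert r R)
  show ?case
  proof (cases "\<forall>c\<in>C. a r c = 0")
    case True
    have "card R < card C" using insert by simp
    from insert.IH[OF insert.prems(1) this, of a] obtain x where
      x: "\<exists>c\<in>C. x c \<noteq> 0" "\<forall>r\<in>R. (\<Sum>c\<in>C. a r c * x c) = 0" by blast
    have "(\<Sum>c\<in>C. a r c * x c) = 0" using True by simp
    with x show ?thesis by (intro exI[of _ x]) simp
  next
    case False
    then obtain c0 where c0: "c0 \<in> C" "a r c0 \<noteq> 0" by blast
    define C' where "C' = C - {c0}"
    have C': "finite C'" "card R < card C'" unfolding C'_def using insert c0 by auto
    define q where "q s = a s c0 * inverse (a r c0)" for s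
    from insert.IH[OF C', of "\<lambda>s c. a s c - q s * a r c"] obtain x where
      x: "\<exists>c\<in>C'. x c \<noteq> 0" "\<And>s. s \<in> R \<Longrightarrow> (\<Sum>c\<in>C'. (a s c - q s * a r c) * x c) = 0"
      by blast
    define S where "S = (\<Sum>c\<in>C'. a r c * x c)"
    define y where "y = x(c0 := - (inverse (a r c0) * S))"
    have sum_y: "(\<Sum>c\<in>C. a s c * y c) = (\<Sum>c\<in>C'. a s c * x c) - q s * S" for s
    proof -
      have "(\<Sum>c\<in>C. a s c * y c) = a s c0 * y c0 + (\<Sum>c\<in>C'. a s c * y c)"
        unfolding C'_def using insert.prems(1) c0(1) by (simp add: sum.remove)
      also have "(\<Sum>c\<in>C'. a s c * y c) = (\<Sum>c\<in>C'. a s c * x c)"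
        by (rule sum.cong) (auto simp: y_def C'_def)
      finally show ?thesis by (simp add: y_def q_def mult.assoc)
    qed
    have "(\<Sum>c\<in>C. a s c * y c) = 0" if "s \<in> insert r R" for s
    proof (cases "s = r")
      case True
      then show ?thesis using c0(2) by (simp add: sum_y q_def S_def)
    next
      case False
      with that x(2)[of s] have "(\<Sum>c\<in>C'. a s c * x c) - q s * S = 0"
        by (simp add: S_def left_diff_distrib sum_subtractf sum_distrib_left mult.assoc)
      then show ?thesis by (simp add: sum_y)
    qed
    moreover have "\<exists>c\<in>C. y c \<noteq> 0" using x(1) unfolding y_def C'_def by auto
    ultimately show ?thesis by blast
  qed
qed

text \<open>\<open>p i c\<close> is coordinate \<open>i\<close> of column \<open>c\<close>. Families indexed by \<open>C\<close> are used instead of sets of vectors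
so that equal columns with different indices count as dependent.\<close>
definition indep_cols :: "nat \<Rightarrow> (nat \<Rightarrow> 'c \<Rightarrow> quat) \<Rightarrow> 'c set \<Rightarrow> bool" where
  "indep_cols d p C \<longleftrightarrow> (\<forall>y. (\<forall>i<d. (\<Sum>c\<in>C. p i c * y c) = 0) \<longrightarrow> (\<forall>c\<in>C. y c = 0))"

lemma indep_colsD:
  "indep_cols d p C \<Longrightarrow> (\<And>i. i < d \<Longrightarrow> (\<Sum>c\<in>C. p i c * y c) = 0) \<Longrightarrow> c \<in> C \<Longrightarrow> y c = 0"
  unfolding indep_cols_def by blast

lemma indep_cols_subset:
  assumes "indep_cols d p C" and "C' \<subseteq> C" and "finite C"
  shows "indep_cols d p C'"
  unfolding indep_cols_def
proof (intro allI impI ballI)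
  fix y c assume y: "\<forall>i<d. (\<Sum>c\<in>C'. p i c * y c) = 0" and c: "c \<in> C'"
  let ?y = "\<lambda>c. if c \<in> C' then y c else 0"
  have "(\<Sum>c\<in>C. p i c * ?y c) = (\<Sum>c\<in>C'. p i c * y c)" for i
    by (rule sum.mono_neutral_cong_right) (use assms in auto)
  then have "?y c = 0"
    using indep_colsD[OF assms(1), of ?y c] y c assms(2) by auto
  then show "y c = 0" using c by simp
qed

text \<open>Steinitz: more than \<open>card R\<close> combinations of \<open>card R\<close> vectors satisfy a nontrivial relation, by
solving a homogeneous system for its coefficients.\<close>
lemma card_indep_cols_le:
  assumes "indep_cols d p C" and "finite C" and "finite R"
    and "\<And>i c. i < d \<Longrightarrow> c \<in> C \<Longrightarrow> p i c = (\<Sum>r\<in>R. w i r * a r c)"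
  shows "card C \<le> card R"
proof (rule ccontr)
  assume "\<not> card C \<le> card R"
  then obtain x where x: "\<exists>c\<in>C. x c \<noteq> 0" "\<forall>r\<in>R. (\<Sum>c\<in>C. a r c * x c) = 0"
    using homogeneous_system_nontrivial[OF assms(3,2), of a] by auto
  have "(\<Sum>c\<in>C. p i c * x c) = 0" if "i < d" for i
  proof -
    have "(\<Sum>c\<in>C. p i c * x c) = (\<Sum>c\<in>C. \<Sum>r\<in>R. w i r * (a r c * x c))"
      using assms(4)[OF that] by (simp add: sum_distrib_right mult.assoc)
    also have "\<dots> = (\<Sum>r\<in>R. w i r * (\<Sum>c\<in>C. a r c * x c))"
      by (subst sum.swap) (simp add: sum_distrib_left)
    finally show ?thesis using x(2) by simp
  qed
  with indep_colsD[OF assms(1), of x] x(1) show False by blast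
qed

lemma in_span_of_maximal:
  assumes "indep_cols d p C" and "finite C" and "\<not> indep_cols d p (insert s C) \<or> s \<in> C"
  shows "\<exists>y. \<forall>i<d. p i s = (\<Sum>c\<in>C. p i c * y c)"
proof (cases "s \<in> C")
  case True
  have "(\<Sum>c\<in>C. p i c * (if c = s then 1 else 0)) = p i s" for i
    using True assms(2) by (simp add: if_distrib[of "(*) _"] sum.delta cong: if_cong)
  then show ?thesis by (intro exI[of _ "\<lambda>c. if c = s then 1 else 0"]) simp
next
  case False
  with assms obtain y where y: "\<forall>i<d. (\<Sum>c\<in>insert s C. p i c * y c) = 0"
    and nz: "\<exists>c\<in>insert s C. y c \<noteq> 0" unfolding indep_cols_def by blast
  have eq: "p i s * y s = - (\<Sum>c\<in>C. p i c * y c)" if "i < d" for i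
    using y that False assms(2) by (simp add: eq_neg_iff_add_eq_0)
  have "y s \<noteq> 0"
  proof
    assume 0: "y s = 0"
    then have "(\<Sum>c\<in>C. p i c * y c) = 0" if "i < d" for i
      using eq[OF that] by simp
    from indep_colsD[OF assms(1), of y, OF this] nz 0 show False by auto
  qed
  have "p i s = (\<Sum>c\<in>C. p i c * - (y c * inverse (y s)))" if "i < d" for i
  proof -
    have "p i s = p i s * y s * inverse (y s)"
      using \<open>y s \<noteq> 0\<close> by (simp add: mult.assoc)
    also have "\<dots> = (\<Sum>c\<in>C. p i c * - (y c * inverse (y s)))"
      unfolding eq[OF that] by (simp add: sum_distrib_right mult.assoc sum_negf)
    finally show ?thesis .
  qed
  then show ?thesis by (intro exI[of _ "\<lambda>c. - (y c * inverse (y s))"]) simp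
qed

section \<open>Rank\<close>

lemma sum_delta_right:
  "finite A \<Longrightarrow> (\<Sum>t\<in>A. f t * (if t = s then c else 0)) = (if s \<in> A then f s * c else 0)"
  for f :: "'a \<Rightarrow> quat"
  by (simp add: if_distrib[of "(*) _"] sum.delta cong: if_cong)

lemma right_basis_card_le:
  assumes "right_basis d S B" and "right_basis d S B'"
  shows "card B \<le> card B'"
proof -
  have fin: "finite B" "finite B'" using assms unfolding right_basis_def by auto
  have "indep_cols d (\<lambda>i v. v $ i) B"
    using assms(1) unfolding right_basis_def right_indep_def indep_cols_def right_lincomb_def
    by (auto simp: vec_eq_iff)
  moreover have "\<exists>c. \<forall>i<d. v $ i = (\<Sum>w\<in>B'. w $ i * c w)" if v: "v \<in> B" for v
  proof -
    have "right_lincomb d B (\<lambda>w. if w = v then 1 else 0) = v"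
      using v assms(1) unfolding right_lincomb_def right_basis_def
      by (intro eq_vecI) (auto simp: sum_delta_right)
    then have "v \<in> S" using assms(1) unfolding right_basis_def right_span_def by (metis rangeI)
    then obtain c where "v = right_lincomb d B' c"
      using assms(2) unfolding right_basis_def right_span_def by auto
    then show ?thesis unfolding right_lincomb_def by (intro exI[of _ c]) auto
  qed
  then obtain a where "\<And>v i. v \<in> B \<Longrightarrow> i < d \<Longrightarrow> v $ i = (\<Sum>w\<in>B'. w $ i * a v w)"
    by metis
  ultimately show ?thesis
    using card_indep_cols_le[OF _ fin, of d "\<lambda>i v. v $ i" "\<lambda>i w. w $ i" "\<lambda>w v. a v w"] by blast
qed

lemma qrank_eq_card:
  assumes "right_basis (dim_row M) (right_col_space M) B"
  shows "qrank M = card B"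
proof -
  have "right_basis (dim_row M) (right_col_space M) (SOME B. right_basis (dim_row M) (right_col_space M) B)"
    using assms by (rule someI)
  then show ?thesis
    unfolding qrank_def right_dim_def using right_basis_card_le assms by (metis antisym)
qed

text \<open>Passage from sets of column indices to sets of vectors, in terms of which the rank is defined.\<close>
lemma right_basis_of_columns:
  assumes \<beta>: "\<beta> \<subseteq> {..<dim_col M}" and ind: "indep_cols (dim_row M) (entry M) \<beta>"
    and span: "\<And>s. s < dim_col M \<Longrightarrow> \<exists>y. \<forall>i<dim_row M. M $$ (i, s) = (\<Sum>t\<in>\<beta>. M $$ (i, t) * y t)"
  shows "right_basis (dim_row M) (right_col_space M) (col M ` \<beta>)" and "inj_on (col M) \<beta>"
proof -
  have fin: "finite \<beta>" using \<beta> finite_subset by blast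
  show inj: "inj_on (col M) \<beta>"
  proof (rule inj_onI, rule ccontr)
    fix s t assume st: "s \<in> \<beta>" "t \<in> \<beta>" "col M s = col M t" "s \<noteq> t"
    let ?y = "\<lambda>c. (if c = s then 1 else 0) - (if c = t then 1 else 0 :: quat)"
    have "(\<Sum>c\<in>\<beta>. M $$ (i, c) * ?y c) = 0" if "i < dim_row M" for i
    proof -
      have "M $$ (i, s) = M $$ (i, t)"
        using st \<beta> that by (metis index_col lessThan_iff subsetD)
      then show ?thesis using st fin
        by (simp add: right_diff_distrib sum_subtractf sum_delta_right)
    qed
    from indep_colsD[OF ind this st(1)] st(4) show False by simp
  qed
  have lincomb: "right_lincomb (dim_row M) (col M ` \<beta>) c =
      vec (dim_row M) (\<lambda>i. \<Sum>t\<in>\<beta>. M $$ (i, t) * c (col M t))" for c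
    unfolding right_lincomb_def sum.reindex[OF inj] o_def
    by (rule eq_vecI) (use \<beta> in \<open>auto intro!: sum.cong\<close>)
  have "right_indep (dim_row M) (col M ` \<beta>)"
    unfolding right_indep_def lincomb
  proof (intro allI impI ballI)
    fix c v assume "vec (dim_row M) (\<lambda>i. \<Sum>t\<in>\<beta>. M $$ (i, t) * c (col M t)) = 0\<^sub>v (dim_row M)"
      and "v \<in> col M ` \<beta>"
    then have 0: "(\<Sum>t\<in>\<beta>. M $$ (i, t) * c (col M t)) = 0" if "i < dim_row M" for i
      using that by (auto simp: vec_eq_iff)
    from indep_colsD[OF ind, of "\<lambda>t. c (col M t)", OF 0] \<open>v \<in> col M ` \<beta>\<close>
    show "c v = 0" by auto
  qed
  moreover have "right_span (dim_row M) (col M ` \<beta>) = right_col_space M"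
  proof (intro equalityI subsetI)
    fix v assume "v \<in> right_span (dim_row M) (col M ` \<beta>)"
    then obtain c where c: "v = right_lincomb (dim_row M) (col M ` \<beta>) c"
      unfolding right_span_def by auto
    let ?x = "vec (dim_col M) (\<lambda>t. if t \<in> \<beta> then c (col M t) else 0)"
    have "v = M *\<^sub>v ?x"
    proof (rule eq_vecI)
      fix i assume "i < dim_vec (M *\<^sub>v ?x)"
      then have "(M *\<^sub>v ?x) $ i = (\<Sum>t<dim_col M. M $$ (i, t) * (if t \<in> \<beta> then c (col M t) else 0))"
        by (simp add: scalar_prod_def lessThan_atLeast0)
      also have "\<dots> = (\<Sum>t\<in>\<beta>. M $$ (i, t) * c (col M t))"
        by (rule sum.mono_neutral_cong_right) (use \<beta> in auto)
      finally show "v $ i = (M *\<^sub>v ?x) $ i"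
        using \<open>i < dim_vec (M *\<^sub>v ?x)\<close> unfolding c lincomb by simp
    qed (simp add: c lincomb)
    then show "v \<in> right_col_space M" unfolding right_col_space_def by auto
  next
    fix v assume "v \<in> right_col_space M"
    then obtain x where x: "v = M *\<^sub>v x" "x \<in> carrier_vec (dim_col M)"
      unfolding right_col_space_def by auto
    obtain y where y: "\<And>s i. s < dim_col M \<Longrightarrow> i < dim_row M \<Longrightarrow>
        M $$ (i, s) = (\<Sum>t\<in>\<beta>. M $$ (i, t) * y s t)"
      using span by metis
    define z where "z t = (\<Sum>s<dim_col M. y s t * x $ s)" for t
    define c where "c v = z (the_inv_into \<beta> (col M) v)" for v
    have "v = right_lincomb (dim_row M) (col M ` \<beta>) c"
    proof (rule eq_vecI)
      fix i assume "i < dim_vec (right_lincomb (dim_row M) (col M ` \<beta>) c)"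
      then have i: "i < dim_row M" by (simp add: right_lincomb_def)
      have "v $ i = (\<Sum>s<dim_col M. M $$ (i, s) * x $ s)"
        using i x by (simp add: scalar_prod_def lessThan_atLeast0)
      also have "\<dots> = (\<Sum>s<dim_col M. \<Sum>t\<in>\<beta>. M $$ (i, t) * (y s t * x $ s))"
      proof (rule sum.cong)
        fix s assume "s \<in> {..<dim_col M}"
        then have "M $$ (i, s) = (\<Sum>t\<in>\<beta>. M $$ (i, t) * y s t)" using y i by simp
        then show "M $$ (i, s) * x $ s = (\<Sum>t\<in>\<beta>. M $$ (i, t) * (y s t * x $ s))"
          by (simp only: sum_distrib_right mult.assoc)
      qed simp
      also have "\<dots> = (\<Sum>t\<in>\<beta>. M $$ (i, t) * z t)"
        unfolding z_def by (subst sum.swap) (simp add: sum_distrib_left)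
      also have "\<dots> = (\<Sum>t\<in>\<beta>. M $$ (i, t) * c (col M t))"
        unfolding c_def using inj by (simp add: the_inv_into_f_f)
      finally show "v $ i = right_lincomb (dim_row M) (col M ` \<beta>) c $ i"
        unfolding lincomb using i by simp
    qed (simp add: x right_lincomb_def)
    then show "v \<in> right_span (dim_row M) (col M ` \<beta>)" unfolding right_span_def by auto
  qed
  ultimately show "right_basis (dim_row M) (right_col_space M) (col M ` \<beta>)"
    unfolding right_basis_def using fin by auto
qed

lemma exists_column_basis:
  obtains \<beta> where "\<beta> \<subseteq> {..<dim_col M}" and "indep_cols (dim_row M) (entry M) \<beta>"
    and "card \<beta> = qrank M"
    and "\<forall>s<dim_col M. \<exists>y. \<forall>i<dim_row M. M $$ (i, s) = (\<Sum>t\<in>\<beta>. M $$ (i, t) * y t)"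
proof -
  let ?Q = "\<lambda>\<beta>. \<beta> \<subseteq> {..<dim_col M} \<and> indep_cols (dim_row M) (entry M) \<beta>"
  have "?Q {}" unfolding indep_cols_def by simp
  moreover have "card \<beta> < Suc (dim_col M)" if "?Q \<beta>" for \<beta>
    using that card_mono[of "{..<dim_col M}" \<beta>] by simp
  ultimately obtain \<beta> where \<beta>: "?Q \<beta>" and max: "\<And>\<gamma>. ?Q \<gamma> \<Longrightarrow> card \<gamma> \<le> card \<beta>"
    using ex_has_greatest_nat[of ?Q "{}" card "Suc (dim_col M)"] by blast
  have fin: "finite \<beta>" using \<beta> finite_subset by blast
  have span: "\<exists>y. \<forall>i<dim_row M. M $$ (i, s) = (\<Sum>t\<in>\<beta>. M $$ (i, t) * y t)" if "s < dim_col M" for s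
  proof (rule in_span_of_maximal[of _ "entry M"])
    show "\<not> indep_cols (dim_row M) (entry M) (insert s \<beta>) \<or> s \<in> \<beta>"
      using max[of "insert s \<beta>"] that \<beta> fin by (cases "s \<in> \<beta>") auto
  qed (use \<beta> fin in auto)
  have "card \<beta> = qrank M"
    using qrank_eq_card right_basis_of_columns[OF _ _ span] \<beta> card_image by metis
  with that \<beta> span show ?thesis by blast
qed

lemma card_indep_cols_le_qrank:
  assumes "\<gamma> \<subseteq> {..<dim_col M}" and "indep_cols (dim_row M) (entry M) \<gamma>"
  shows "card \<gamma> \<le> qrank M"
proof -
  obtain \<beta> where \<beta>: "\<beta> \<subseteq> {..<dim_col M}" "indep_cols (dim_row M) (entry M) \<beta>"
    "card \<beta> = qrank M"
    "\<forall>s<dim_col M. \<exists>y. \<forall>i<dim_row M. M $$ (i, s) = (\<Sum>t\<in>\<beta>. M $$ (i, t) * y t)"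
    by (rule exists_column_basis[of M])
  then obtain y where "\<And>s i. s < dim_col M \<Longrightarrow> i < dim_row M \<Longrightarrow>
      M $$ (i, s) = (\<Sum>t\<in>\<beta>. M $$ (i, t) * y s t)" by metis
  then have "card \<gamma> \<le> card \<beta>"
    by (intro card_indep_cols_le[OF assms(2), of \<beta> "entry M" "\<lambda>t s. y s t"])
      (use assms(1) finite_subset[OF assms(1)] finite_subset[OF \<beta>(1)] in auto)
  then show ?thesis using \<beta>(3) by simp
qed

lemma indep_cols_of_full_card_span:
  assumes "\<beta> \<subseteq> {..<dim_col M}" and "indep_cols (dim_row M) (entry M) \<beta>"
    and "card \<beta> = qrank M" and "s < dim_col M"
  shows "\<exists>y. \<forall>i<dim_row M. M $$ (i, s) = (\<Sum>t\<in>\<beta>. M $$ (i, t) * y t)"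
proof (rule in_span_of_maximal[of _ "entry M"])
  have fin: "finite \<beta>" using assms(1) finite_subset by blast
  show "\<not> indep_cols (dim_row M) (entry M) (insert s \<beta>) \<or> s \<in> \<beta>"
    using card_indep_cols_le_qrank[of "insert s \<beta>" M] assms fin by (cases "s \<in> \<beta>") auto
qed (use assms finite_subset in auto)

section \<open>Gram matrices\<close>

text \<open>The matrix \<open>P\<^sup>* P\<close>, as a function on indices; \<open>d\<close> is the number of rows of \<open>P\<close>.\<close>
definition gram :: "nat \<Rightarrow> (nat \<Rightarrow> 'c \<Rightarrow> quat) \<Rightarrow> 'c \<Rightarrow> 'c \<Rightarrow> quat" where
  "gram d p x y = (\<Sum>i<d. qcnj (p i x) * p i y)"

lemma hermitian_gram: "hermitian_on S (gram d p)"
  unfolding hermitian_on_def gram_def by (simp add: qcnj_sum qcnj_mult)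

lemma qcnj_gram: "qcnj (gram d p x y) = gram d p y x"
  unfolding gram_def by (simp add: qcnj_sum qcnj_mult)

lemma gram_apply:
  "(\<Sum>s\<in>\<beta>. gram d p t s * z s) = (\<Sum>i<d. qcnj (p i t) * (\<Sum>s\<in>\<beta>. p i s * z s))"
  unfolding gram_def sum_distrib_right sum_distrib_left
  by (subst sum.swap) (simp add: mult.assoc)

lemma gram_form:
  "(\<Sum>t\<in>\<beta>. qcnj (z t) * (\<Sum>s\<in>\<beta>. gram d p t s * z s)) =
    (\<Sum>i<d. qnormsq (\<Sum>s\<in>\<beta>. p i s * z s)) *\<^sub>R 1"
proof -
  define v where "v i = (\<Sum>s\<in>\<beta>. p i s * z s)" for i
  have "(\<Sum>t\<in>\<beta>. qcnj (z t) * (\<Sum>s\<in>\<beta>. gram d p t s * z s)) =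
      (\<Sum>t\<in>\<beta>. \<Sum>i<d. qcnj (p i t * z t) * v i)"
    unfolding gram_apply v_def[symmetric] by (simp add: sum_distrib_left qcnj_mult mult.assoc)
  also have "\<dots> = (\<Sum>i<d. qcnj (v i) * v i)"
    by (subst sum.swap) (simp add: v_def qcnj_sum sum_distrib_right)
  finally show ?thesis
    unfolding v_def[symmetric] by (simp add: quat_mult_qcnj scaleR_sum_left)
qed

lemma qnormsq_nonneg: "0 \<le> qnormsq x"
  by (simp add: qnormsq_def)

text \<open>If \<open>P\<^sup>* P z = 0\<close> then \<open>z\<^sup>* P\<^sup>* P z\<close>, a sum of squared norms, vanishes.\<close>
lemma gram_kernel:
  assumes "\<And>t. t \<in> \<beta> \<Longrightarrow> (\<Sum>s\<in>\<beta>. gram d p t s * z s) = 0" and "i < d"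
  shows "(\<Sum>s\<in>\<beta>. p i s * z s) = 0"
proof -
  have "(\<Sum>i<d. qnormsq (\<Sum>s\<in>\<beta>. p i s * z s)) *\<^sub>R (1 :: quat) = 0"
    using gram_form[of z d p \<beta>] assms(1) by simp
  then have "(\<Sum>i<d. qnormsq (\<Sum>s\<in>\<beta>. p i s * z s)) = 0" by simp
  then have "qnormsq (\<Sum>s\<in>\<beta>. p i s * z s) = 0"
    using assms(2) by (subst (asm) sum_nonneg_eq_0_iff) (auto simp: qnormsq_nonneg)
  then show ?thesis by (simp add: qnormsq_eq_0_iff)
qed

text \<open>Let \<open>z\<close> be the Cramer solution for the unit vector at \<open>s\<close>. Its entry at \<open>s\<close> is the minor on
\<open>\<beta> - {s}\<close>, so the form \<open>z\<^sup>* P\<^sup>* P z \<ge> 0\<close> equals the product of the minors on \<open>\<beta> - {s}\<close> and \<open>\<beta>\<close>,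
and the sign passes from the smaller set to the larger one. If the product is zero then
\<open>P z = 0\<close>, which forces the larger minor to vanish, and for independent columns also \<open>z = 0\<close>,
contradicting that the smaller minor is positive.\<close>
lemma cycle_det_gram_nonneg:
  fixes \<beta> :: "'c::linorder set"
  assumes "finite \<beta>"
  shows "0 \<le> cycle_det (gram d p) \<beta> \<and> (indep_cols d p \<beta> \<longrightarrow> 0 < cycle_det (gram d p) \<beta>)"
  using assms
proof (induction "card \<beta>" arbitrary: \<beta> rule: less_induct)
  case less
  let ?D = "cycle_det (gram d p)"
  show ?case
  proof (cases "\<beta> = {}")
    case True
    then show ?thesis by simp
  next
    case False
    then obtain s where s: "s \<in> \<beta>" by blast
    define b :: "'c \<Rightarrow> quat" where "b = (\<lambda>x. if x = s then 1 else 0)"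
    define z where "z t = cramer (gram d p) \<beta> t b" for t
    define v where "v i = (\<Sum>t\<in>\<beta>. p i t * z t)" for i
    have solves: "(\<Sum>t\<in>\<beta>. gram d p u t * z t) = ?D \<beta> *\<^sub>R b u" if "u \<in> \<beta>" for u
      unfolding z_def by (rule cramer_solves[OF less(2) that hermitian_gram])
    have zs: "z s = ?D (\<beta> - {s}) *\<^sub>R 1"
      unfolding z_def b_def by (rule cramer_unit[OF less(2) s])
    have "(\<Sum>t\<in>\<beta>. qcnj (z t) * (\<Sum>u\<in>\<beta>. gram d p t u * z u)) = qcnj (z s) * ?D \<beta> *\<^sub>R 1"
      using s less(2) by (simp add: solves b_def sum_delta_right if_distrib[of "scaleR _"]
          if_distrib[of "(*) _"] sum.delta cong: if_cong)
    then have "(\<Sum>i<d. qnormsq (v i)) *\<^sub>R (1 :: quat) = (?D (\<beta> - {s}) * ?D \<beta>) *\<^sub>R 1"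
      unfolding gram_form v_def[symmetric] zs by (simp add: qcnj_scaleR mult.commute)
    then have prod: "?D (\<beta> - {s}) * ?D \<beta> = (\<Sum>i<d. qnormsq (v i))" by simp
    have "card (\<beta> - {s}) < card \<beta>" by (rule card_Diff1_less[OF less(2) s])
    from less(1)[OF this] less(2) have IH: "0 \<le> ?D (\<beta> - {s})"
      "indep_cols d p (\<beta> - {s}) \<Longrightarrow> 0 < ?D (\<beta> - {s})" by auto
    have v0: "v i = 0" if "?D (\<beta> - {s}) * ?D \<beta> = 0" "i < d" for i
    proof -
      have "(\<Sum>i<d. qnormsq (v i)) = 0" using that(1) prod by simp
      then have "qnormsq (v i) = 0"
        using that(2) by (subst (asm) sum_nonneg_eq_0_iff) (auto simp: qnormsq_nonneg)
      then show ?thesis by (simp add: qnormsq_eq_0_iff)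
    qed
    have nonneg: "0 \<le> ?D \<beta>"
    proof (cases "?D (\<beta> - {s}) = 0")
      case True
      then have "(\<Sum>t\<in>\<beta>. gram d p s t * z t) = 0"
        using v0 unfolding gram_apply v_def[symmetric] by simp
      then show ?thesis using solves[OF s] by (simp add: b_def)
    next
      case False
      with IH(1) have "0 < ?D (\<beta> - {s})" by simp
      moreover have "0 \<le> ?D (\<beta> - {s}) * ?D \<beta>" unfolding prod by (simp add: sum_nonneg qnormsq_nonneg)
      ultimately show ?thesis by (simp add: zero_le_mult_iff)
    qed
    moreover have "0 < ?D \<beta>" if ind: "indep_cols d p \<beta>"
    proof (rule ccontr)
      assume "\<not> 0 < ?D \<beta>"
      with nonneg have "?D \<beta> = 0" by simp
      then have "v i = 0" if "i < d" for i using v0 that by simp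
      then have "z s = 0" using indep_colsD[OF ind, of z s] s unfolding v_def by blast
      moreover have "0 < ?D (\<beta> - {s})"
        by (rule IH(2)) (rule indep_cols_subset[OF ind], use less(2) in auto)
      ultimately show False unfolding zs by simp
    qed
    ultimately show ?thesis by blast
  qed
qed

text \<open>The Cramer solutions for the unit vectors form a right inverse of the matrix up to the nonzero real
factor; conjugating turns it into a left inverse, since the matrix is Hermitian.\<close>
lemma indep_cols_of_cycle_det:
  assumes fin: "finite \<beta>" and D: "cycle_det (gram d p) \<beta> \<noteq> 0"
  shows "indep_cols d p \<beta>"
  unfolding indep_cols_def
proof (intro allI impI ballI)
  fix y s assume y: "\<forall>i<d. (\<Sum>t\<in>\<beta>. p i t * y t) = 0" and s: "s \<in> \<beta>"
  define b where "b = (\<lambda>x. if x = s then 1 else 0 :: quat)"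
  define z where "z t = cramer (gram d p) \<beta> t b" for t
  have solves: "(\<Sum>t\<in>\<beta>. gram d p u t * z t) = cycle_det (gram d p) \<beta> *\<^sub>R b u" if "u \<in> \<beta>" for u
    unfolding z_def by (rule cramer_solves[OF fin that hermitian_gram])
  have "0 = (\<Sum>t\<in>\<beta>. qcnj (z t) * (\<Sum>u\<in>\<beta>. gram d p t u * y u))"
    using y by (simp add: gram_apply)
  also have "\<dots> = (\<Sum>u\<in>\<beta>. (\<Sum>t\<in>\<beta>. qcnj (z t) * qcnj (gram d p u t)) * y u)"
    unfolding sum_distrib_left sum_distrib_right
    by (subst sum.swap) (simp add: qcnj_gram mult.assoc)
  also have "\<dots> = (\<Sum>u\<in>\<beta>. qcnj (cycle_det (gram d p) \<beta> *\<^sub>R b u) * y u)"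
    by (simp flip: qcnj_mult qcnj_sum solves)
  also have "\<dots> = (\<Sum>u\<in>\<beta>. if u = s then cycle_det (gram d p) \<beta> *\<^sub>R y u else 0)"
    by (rule sum.cong) (auto simp: b_def qcnj_scaleR)
  finally show "y s = 0" using D s fin by (simp add: sum.delta)
qed

text \<open>The equation is proved separately for each \<open>\<beta>\<close>. By Cramer's rule it holds in the rows \<open>u \<in> \<beta>\<close>.
If the minor on \<open>\<beta>\<close> is nonzero, every column of \<open>P\<close> is a combination of those in \<open>\<beta>\<close>, so the
remaining rows follow. If it is zero, \<open>z\<close> is killed by the principal submatrix, hence by the columns
of \<open>P\<close> in \<open>\<beta>\<close>, and both sides vanish.\<close>
theorem cramer_rank_solution:
  fixes P :: "quat mat"
  defines "g \<equiv> gram (dim_row P) (entry P)"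
  defines "c \<equiv> \<lambda>w t. \<Sum>i<dim_row P. qcnj (P $$ (i, t)) * w i"
  assumes u: "u < dim_col P"
  shows "(\<Sum>t<dim_col P. g u t * (\<Sum>\<beta>\<in>index_sets_at (qrank P) (dim_col P) t. cramer g \<beta> t (c w))) =
    (\<Sum>\<beta>\<in>index_sets (qrank P) (dim_col P). cycle_det g \<beta>) *\<^sub>R c w u"
proof -
  let ?d = "dim_row P" and ?N = "dim_col P" and ?r = "qrank P"
  have finI: "finite (index_sets ?r ?N)"
    unfolding index_sets_def by (rule finite_subset[of _ "Pow {..<?N}"]) auto
  have "(\<Sum>t<?N. g u t * (\<Sum>\<beta>\<in>index_sets_at ?r ?N t. cramer g \<beta> t (c w))) =
      (\<Sum>t<?N. \<Sum>\<beta> | \<beta> \<in> index_sets ?r ?N \<and> t \<in> \<beta>. g u t * cramer g \<beta> t (c w))"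
    unfolding index_sets_at_def by (simp add: sum_distrib_left)
  also have "\<dots> = (\<Sum>\<beta>\<in>index_sets ?r ?N. \<Sum>t | t \<in> {..<?N} \<and> t \<in> \<beta>. g u t * cramer g \<beta> t (c w))"
    by (rule sum.swap_restrict) (use finI in auto)
  also have "\<dots> = (\<Sum>\<beta>\<in>index_sets ?r ?N. cycle_det g \<beta> *\<^sub>R c w u)"
  proof (rule sum.cong)
    fix \<beta> assume "\<beta> \<in> index_sets ?r ?N"
    then have \<beta>: "\<beta> \<subseteq> {..<?N}" "card \<beta> = ?r" unfolding index_sets_def by auto
    have fin: "finite \<beta>" using \<beta>(1) finite_subset by blast
    define z where "z t = cramer g \<beta> t (c w)" for t
    have solves: "(\<Sum>t\<in>\<beta>. g s t * z t) = cycle_det g \<beta> *\<^sub>R c w s" if "s \<in> \<beta>" for s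
      unfolding z_def g_def by (rule cramer_solves[OF fin that hermitian_gram])
    have "(\<Sum>t\<in>\<beta>. g u t * z t) = cycle_det g \<beta> *\<^sub>R c w u"
    proof (cases "cycle_det g \<beta> = 0")
      case True
      have "(\<Sum>s\<in>\<beta>. P $$ (i, s) * z s) = 0" if "i < ?d" for i
        by (rule gram_kernel[of \<beta> ?d "entry P" z, OF _ that])
          (use solves True in \<open>simp add: g_def\<close>)
      then show ?thesis unfolding g_def gram_apply by (simp add: True[unfolded g_def])
    next
      case False
      then have "indep_cols ?d (entry P) \<beta>"
        unfolding g_def by (rule indep_cols_of_cycle_det[OF fin])
      from indep_cols_of_full_card_span[OF \<beta>(1) this \<beta>(2) u] obtain y
        where y: "\<And>i. i < ?d \<Longrightarrow> P $$ (i, u) = (\<Sum>t\<in>\<beta>. P $$ (i, t) * y t)" by blast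
      have pu: "(\<Sum>i<?d. qcnj (P $$ (i, u)) * f i) =
          (\<Sum>t\<in>\<beta>. qcnj (y t) * (\<Sum>i<?d. qcnj (P $$ (i, t)) * f i))" for f
      proof -
        have "(\<Sum>i<?d. qcnj (P $$ (i, u)) * f i) =
            (\<Sum>i<?d. \<Sum>t\<in>\<beta>. qcnj (y t) * (qcnj (P $$ (i, t)) * f i))"
          by (rule sum.cong) (auto simp: y qcnj_sum qcnj_mult sum_distrib_right mult.assoc)
        also have "\<dots> = (\<Sum>t\<in>\<beta>. qcnj (y t) * (\<Sum>i<?d. qcnj (P $$ (i, t)) * f i))"
          by (subst sum.swap) (simp add: sum_distrib_left)
        finally show ?thesis .
      qed
      have "(\<Sum>t\<in>\<beta>. g u t * z t) = (\<Sum>t\<in>\<beta>. qcnj (y t) * (\<Sum>s\<in>\<beta>. g t s * z s))"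
        unfolding g_def gram_apply pu ..
      also have "\<dots> = cycle_det g \<beta> *\<^sub>R (\<Sum>t\<in>\<beta>. qcnj (y t) * c w t)"
        by (simp add: solves scaleR_sum_right)
      also have "(\<Sum>t\<in>\<beta>. qcnj (y t) * c w t) = c w u"
        unfolding c_def pu ..
      finally show ?thesis .
    qed
    moreover have "{t. t \<in> {..<?N} \<and> t \<in> \<beta>} = \<beta>" using \<beta>(1) by auto
    ultimately show "(\<Sum>t | t \<in> {..<?N} \<and> t \<in> \<beta>. g u t * cramer g \<beta> t (c w)) = cycle_det g \<beta> *\<^sub>R c w u"
      unfolding z_def by simp
  qed simp
  finally show ?thesis by (simp add: scaleR_sum_left)
qed

lemma sum_principal_minors_pos:
  "0 < (\<Sum>\<beta>\<in>index_sets (qrank P) (dim_col P). cycle_det (gram (dim_row P) (entry P)) \<beta>)"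
proof -
  have finI: "finite (index_sets (qrank P) (dim_col P))"
    unfolding index_sets_def by (rule finite_subset[of _ "Pow {..<dim_col P}"]) auto
  have fin: "finite \<beta>" if "\<beta> \<in> index_sets (qrank P) (dim_col P)" for \<beta>
    using that finite_subset unfolding index_sets_def by auto
  obtain \<beta> where \<beta>: "\<beta> \<subseteq> {..<dim_col P}" "indep_cols (dim_row P) (entry P) \<beta>"
    "card \<beta> = qrank P"
    "\<forall>s<dim_col P. \<exists>y. \<forall>i<dim_row P. P $$ (i, s) = (\<Sum>t\<in>\<beta>. P $$ (i, t) * y t)"
    by (rule exists_column_basis[of P])
  then have mem: "\<beta> \<in> index_sets (qrank P) (dim_col P)" unfolding index_sets_def by auto
  show ?thesis
    by (rule sum_pos2[OF finI mem]) (use cycle_det_gram_nonneg fin \<beta>(2) mem in blast)+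
qed

section \<open>The determinantal entries as solutions of normal equations\<close>

lemma walk_prod_snoc: "xs \<noteq> [] \<Longrightarrow> walk_prod g (xs @ [e]) = walk_prod g xs * g (last xs) e"
  by (induction g xs rule: walk_prod.induct) (auto simp: mult.assoc)

lemma walk_prod_cong_targets:
  "(\<And>x y. x \<in> set (a # xs) \<Longrightarrow> y \<in> set xs \<Longrightarrow> g x y = h x y) \<Longrightarrow>
    walk_prod g (a # xs) = walk_prod h (a # xs)"
proof (induction xs arbitrary: a)
  case (Cons b xs)
  have "walk_prod g (b # xs) = walk_prod h (b # xs)"
    by (rule Cons.IH) (use Cons.prems in auto)
  with Cons.prems[of a b] show ?case by simp
qed simp

text \<open>Within the walk \<open>t # p\<close> no step leads back to \<open>t\<close>, so column \<open>t\<close> is used only by the last step of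
the cycle.\<close>
lemma cdet_replace_col:
  assumes \<beta>: "\<beta> \<subseteq> {..<N}" and t: "t \<in> \<beta>" and G: "G \<in> carrier_mat N N"
    and herm: "hermitian_on \<beta> g" and eq: "\<And>x y. x \<in> \<beta> \<Longrightarrow> y \<in> \<beta> \<Longrightarrow> G $$ (x, y) = g x y"
  shows "cdet \<beta> t (replace_col G b t) = cramer g \<beta> t (\<lambda>x. b $ x)"
proof -
  let ?M = "replace_col G b t"
  have fin: "finite \<beta>" using \<beta> finite_subset by blast
  have M: "?M $$ (x, y) = (if y = t then b $ x else g x y)" if "x \<in> \<beta>" "y \<in> \<beta>" for x y
  proof -
    have "x < N" "y < N" using that \<beta> by auto
    then show ?thesis using G eq[OF that] unfolding replace_col_def by auto
  qed
  have "cdet \<beta> t ?M = (\<Sum>p\<in>arrangements (\<beta> - {t}).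
      ((- 1) ^ length p * cycle_det g (\<beta> - {t} - set p)) *\<^sub>R walk_prod (entry ?M) (t # p @ [t]))"
    unfolding cdet_eq_line_det
    by (rule line_det_hermitian_off_line[OF fin t _ hermitian_on_subset[OF herm]]) (auto simp: M)
  also have "\<dots> = cramer g \<beta> t (\<lambda>x. b $ x)"
    unfolding cramer_def
  proof (rule sum.cong)
    fix p assume p: "p \<in> arrangements (\<beta> - {t})"
    then have sub: "set (t # p) \<subseteq> \<beta>" "t \<notin> set p" using t unfolding arrangements_def by auto
    then have "last (t # p) \<in> \<beta>" using last_in_set[of "t # p"] by blast
    then have "entry ?M (last (t # p)) t = b $ last (t # p)" using M t by simp
    moreover have "walk_prod (entry ?M) (t # p) = walk_prod g (t # p)"
      by (rule walk_prod_cong_targets) (subst M, use sub in auto)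
    ultimately show "((- 1) ^ length p * cycle_det g (\<beta> - {t} - set p)) *\<^sub>R
          walk_prod (entry ?M) (t # p @ [t]) =
        ((- 1) ^ length p * cycle_det g (\<beta> - {t} - set p)) *\<^sub>R
          (walk_prod g (t # p) * b $ last (t # p))"
      using walk_prod_snoc[of "t # p" "entry ?M" t] by simp
  qed simp
  finally show ?thesis .
qed

text \<open>Here the replaced row is used by the first step of the cycle. Conjugation reverses the cycle
and makes this the last step, which is the situation of the column determinant.\<close>
lemma rdet_replace_row:
  assumes \<beta>: "\<beta> \<subseteq> {..<N}" and t: "t \<in> \<beta>" and G: "G \<in> carrier_mat N N"
    and herm: "hermitian_on \<beta> g" and eq: "\<And>x y. x \<in> \<beta> \<Longrightarrow> y \<in> \<beta> \<Longrightarrow> G $$ (x, y) = g x y"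
    and b': "\<And>x. x \<in> \<beta> \<Longrightarrow> b' $ x = qcnj (b $ x)"
  shows "rdet \<beta> t (replace_row G b t) = qcnj (cdet \<beta> t (replace_col G b' t))"
proof -
  let ?M = "replace_row G b t"
  have fin: "finite \<beta>" using \<beta> finite_subset by blast
  have M: "?M $$ (x, y) = (if x = t then b $ y else g x y)" if "x \<in> \<beta>" "y \<in> \<beta>" for x y
  proof -
    have "x < N" "y < N" using that \<beta> by auto
    then show ?thesis using G eq[OF that] unfolding replace_row_def by auto
  qed
  let ?c = "\<lambda>p. (- 1) ^ length p * cycle_det g (\<beta> - {t} - set p)"
  have "rdet \<beta> t ?M = (\<Sum>p\<in>arrangements (\<beta> - {t}). ?c p *\<^sub>R walk_prod (entry ?M) (t # p @ [t]))"
    unfolding rdet_eq_line_det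
    by (rule line_det_hermitian_off_line[OF fin t _ hermitian_on_subset[OF herm]]) (auto simp: M)
  also have "\<dots> = (\<Sum>p\<in>arrangements (\<beta> - {t}). ?c (rev p) *\<^sub>R
      qcnj (walk_prod g (t # rev p) * b' $ last (t # rev p)))"
  proof (rule sum.cong)
    fix p assume p: "p \<in> arrangements (\<beta> - {t})"
    then have sub: "set (t # p) \<subseteq> \<beta>" "t \<notin> set p" using t unfolding arrangements_def by auto
    have "walk_prod (entry ?M) (t # p @ [t]) = b $ last (t # rev p) * walk_prod g (p @ [t])"
    proof (cases p)
      case Nil
      then show ?thesis using M[OF t t] by simp
    next
      case (Cons x q)
      have "walk_prod (entry ?M) (x # q @ [t]) = walk_prod g (x # q @ [t])"
      proof -
        have "walk_prod (entry ?M) (p @ [t]) = walk_prod g (p @ [t])"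
          if "set p \<subseteq> \<beta>" "t \<notin> set p" for p
          using that
        proof (induction p rule: induct_list012)
          case (2 a)
          then show ?case using M[of a t] t by auto
        next
          case (3 a c p)
          then show ?case using M[of a c] by auto
        qed simp
        from this[of p] show ?thesis using sub Cons by simp
      qed
      moreover have "entry ?M t x = b $ x" using M[OF t, of x] sub Cons by simp
      ultimately show ?thesis using Cons by simp
    qed
    also have "\<dots> = qcnj (walk_prod g (t # rev p) * b' $ last (t # rev p))"
    proof -
      have "last (t # rev p) \<in> \<beta>" using last_in_set[of "t # rev p"] sub by fastforce
      then have "qcnj (b' $ last (t # rev p)) = b $ last (t # rev p)" using b' by simp
      moreover have "qcnj (walk_prod g (t # rev p)) = walk_prod g (p @ [t])"
        using walk_prod_rev[OF herm, of "t # rev p"] sub by simp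
      ultimately show ?thesis by (simp only: qcnj_mult)
    qed
    finally show "?c p *\<^sub>R walk_prod (entry ?M) (t # p @ [t]) =
        ?c (rev p) *\<^sub>R qcnj (walk_prod g (t # rev p) * b' $ last (t # rev p))" by simp
  qed simp
  also have "\<dots> = (\<Sum>p\<in>arrangements (\<beta> - {t}). ?c p *\<^sub>R qcnj (walk_prod g (t # p) * b' $ last (t # p)))"
    by (rule sum_arrangements_rev)
  also have "\<dots> = qcnj (cdet \<beta> t (replace_col G b' t))"
    by (subst cdet_replace_col[OF \<beta> t G herm eq]) (simp_all add: cramer_def qcnj_sum qcnj_scaleR)
  finally show ?thesis .
qed

lemma hdet_eq_cycle_det:
  assumes fin: "finite \<beta>" and ne: "\<beta> \<noteq> {}"
    and herm: "hermitian_on \<beta> g" and eq: "\<And>x y. x \<in> \<beta> \<Longrightarrow> y \<in> \<beta> \<Longrightarrow> G $$ (x, y) = g x y"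
  shows "hdet \<beta> G = cycle_det g \<beta>"
proof -
  have line: "line_det h \<beta> t G = of_real (cycle_det g \<beta>)" if t: "t \<in> \<beta>" and h: "h = id \<or> h = rev" for t h
  proof -
    have "line_det h \<beta> t G = (\<Sum>p\<in>arrangements (\<beta> - {t}).
        ((- 1) ^ length p * cycle_det g (\<beta> - {t} - set p)) *\<^sub>R walk_prod (entry G) (t # p @ [t]))"
      by (rule line_det_hermitian_off_line[OF fin t h hermitian_on_subset[OF herm]]) (auto simp: eq)
    also have "\<dots> = (\<Sum>p\<in>arrangements (\<beta> - {t}).
        ((- 1) ^ length p * cycle_det g (\<beta> - {t} - set p)) *\<^sub>R walk_prod g (t # p @ [t]))"
    proof (rule sum.cong)
      fix p assume "p \<in> arrangements (\<beta> - {t})"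
      then have "walk_prod (entry G) (t # p @ [t]) = walk_prod g (t # p @ [t])"
        by (intro walk_prod_cong eq) (use t in \<open>auto simp: arrangements_def\<close>)
      then show "((- 1) ^ length p * cycle_det g (\<beta> - {t} - set p)) *\<^sub>R walk_prod (entry G) (t # p @ [t]) =
        ((- 1) ^ length p * cycle_det g (\<beta> - {t} - set p)) *\<^sub>R walk_prod g (t # p @ [t])" by simp
    qed simp
    finally show ?thesis
      by (simp add: cycle_det_expand_hermitian[OF fin t herm] of_real_def)
  qed
  obtain i where i: "i \<in> \<beta>" using ne by blast
  show ?thesis
    unfolding hdet_def rdet_eq_line_det cdet_eq_line_det
  proof (rule the_equality)
    show "\<forall>i\<in>\<beta>. line_det id \<beta> i G = of_real (cycle_det g \<beta>) \<and>
        line_det rev \<beta> i G = of_real (cycle_det g \<beta>)"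
      using line by blast
    show "d = cycle_det g \<beta>" if "\<forall>i\<in>\<beta>. line_det id \<beta> i G = of_real d \<and>
        line_det rev \<beta> i G = of_real d" for d
      using that i line[OF i, of id] by auto
  qed
qed

lemma dim_ctranspose [simp]:
  "dim_row (ctranspose M) = dim_col M" "dim_col (ctranspose M) = dim_row M"
  unfolding ctranspose_def by simp_all

lemma ctranspose_carrier [simp]: "M \<in> carrier_mat a b \<Longrightarrow> ctranspose M \<in> carrier_mat b a"
  using carrier_matD[of M a b] by (intro carrier_matI) simp_all

lemma index_ctranspose [simp]:
  "i < dim_col M \<Longrightarrow> j < dim_row M \<Longrightarrow> ctranspose M $$ (i, j) = qcnj (M $$ (j, i))"
  unfolding ctranspose_def by simp

lemma ctranspose_ctranspose [simp]: "ctranspose (ctranspose M) = M"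
  by (rule eq_matI) auto

lemma index_mult_sum:
  "i < dim_row A \<Longrightarrow> j < dim_col B \<Longrightarrow> dim_col A = dim_row B \<Longrightarrow>
    (A * B) $$ (i, j) = (\<Sum>t<dim_row B. A $$ (i, t) * B $$ (t, j))"
  by (simp add: scalar_prod_def lessThan_atLeast0)

lemma ctranspose_mult:
  assumes "A \<in> carrier_mat a b" and "B \<in> carrier_mat b c"
  shows "ctranspose (A * B) = ctranspose B * ctranspose A"
proof (rule eq_matI)
  fix i j assume "i < dim_row (ctranspose B * ctranspose A)" "j < dim_col (ctranspose B * ctranspose A)"
  then have ij: "i < c" "j < a" using assms by auto
  then have "ctranspose (A * B) $$ (i, j) = qcnj ((A * B) $$ (j, i))"
    using assms by (subst index_ctranspose) auto
  also have "\<dots> = (\<Sum>t<b. qcnj (B $$ (t, i)) * qcnj (A $$ (j, t)))"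
    using assms ij by (subst index_mult_sum) (auto simp: qcnj_sum qcnj_mult)
  also have "\<dots> = (ctranspose B * ctranspose A) $$ (i, j)"
    using assms ij by (subst index_mult_sum) auto
  finally show "ctranspose (A * B) $$ (i, j) = (ctranspose B * ctranspose A) $$ (i, j)" .
qed (use assms in auto)

lemma ctranspose_one [simp]: "ctranspose (1\<^sub>m n) = 1\<^sub>m n"
  by (rule eq_matI) auto

lemma pow_mat_Suc_left:
  "M \<in> carrier_mat n n \<Longrightarrow> M ^\<^sub>m Suc k = M * M ^\<^sub>m k" for M :: "'a::semiring_1 mat"
proof (induction k)
  case (Suc k)
  then have "M ^\<^sub>m Suc (Suc k) = M * M ^\<^sub>m k * M" by simp
  also have "\<dots> = M * (M ^\<^sub>m k * M)" using Suc by (intro assoc_mult_mat) (auto intro: pow_carrier_mat)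
  finally show ?case by simp
qed simp

lemma ctranspose_pow:
  "M \<in> carrier_mat n n \<Longrightarrow> ctranspose (M ^\<^sub>m k) = ctranspose M ^\<^sub>m k"
proof (induction k)
  case 0
  then have "dim_row M = n" "dim_col M = n" by auto
  then show ?case by (simp only: pow_mat.simps dim_ctranspose ctranspose_one)
next
  case (Suc k)
  have "ctranspose (M ^\<^sub>m Suc k) = ctranspose M * ctranspose (M ^\<^sub>m k)"
    using Suc by (simp add: ctranspose_mult[of _ n n _ n] pow_carrier_mat)
  also have "\<dots> = ctranspose M ^\<^sub>m Suc k"
    using Suc by (simp only: pow_mat_Suc_left[of "ctranspose M" n] ctranspose_carrier)
  finally show ?case .
qed

lemma index_gram:
  assumes "x < dim_col P" and "y < dim_col P"
  shows "(ctranspose P * P) $$ (x, y) = gram (dim_row P) (entry P) x y"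
proof -
  have "(ctranspose P * P) $$ (x, y) = (\<Sum>t<dim_row P. ctranspose P $$ (x, t) * P $$ (t, y))"
    by (rule index_mult_sum) (use assms in simp_all)
  also have "\<dots> = gram (dim_row P) (entry P) x y"
    unfolding gram_def by (rule sum.cong) (use assms in simp_all)
  finally show ?thesis .
qed

lemma divide_of_real_quat: "x / of_real r = inverse r *\<^sub>R x" for x :: quat
proof (cases "r = 0")
  case False
  have "(of_real r :: quat) * (inverse r *\<^sub>R 1) = 1"
    unfolding of_real_def using False by simp
  then have "inverse (of_real r :: quat) = inverse r *\<^sub>R 1"
    by (rule inverse_unique)
  then show ?thesis by (simp add: divide_quat_def)
qed (simp add: divide_quat_def)

text \<open>The columns of \<open>X\<close> are the rank-\<open>r\<close> Cramer solutions for the columns of \<open>M ^\<^sub>m k\<close>, divided by the sum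
of the principal minors.\<close>
lemma drazin_entry1_normal_equation:
  assumes M: "M \<in> carrier_mat N N" and r: "qrank (M ^\<^sub>m k) = qrank (M ^\<^sub>m (2 * k + 1))"
    and pos: "1 \<le> qrank (M ^\<^sub>m k)"
  defines "P \<equiv> M ^\<^sub>m (2 * k + 1)"
  shows "\<exists>X\<in>carrier_mat N N. mat N N (\<lambda>(i, j). drazin_entry1 k M i j) = M ^\<^sub>m k * X \<and>
    ctranspose P * P * X = ctranspose P * M ^\<^sub>m k"
proof -
  let ?g = "gram N (entry P)" and ?r = "qrank P" and ?Mk = "M ^\<^sub>m k" and ?G = "ctranspose P * P"
  let ?d = "\<Sum>\<beta>\<in>index_sets ?r N. cycle_det ?g \<beta>"
  have P: "P \<in> carrier_mat N N" and Mk: "?Mk \<in> carrier_mat N N"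
    unfolding P_def using M by (auto intro: pow_carrier_mat)
  then have dims: "dim_row P = N" "dim_col P = N" "dim_row ?Mk = N" "dim_col ?Mk = N"
    "dim_row M = N" using M by auto
  have G: "?G \<in> carrier_mat N N" using P by auto
  define c where "c j t = (\<Sum>i<N. qcnj (P $$ (i, t)) * ?Mk $$ (i, j))" for j t
  define x where "x j t = (\<Sum>\<beta>\<in>index_sets_at ?r N t. cramer ?g \<beta> t (c j))" for j t
  define X where "X = mat N N (\<lambda>(t, j). inverse ?d *\<^sub>R x j t)"
  have X: "X \<in> carrier_mat N N" unfolding X_def by simp
  have sets: "\<beta> \<subseteq> {..<N}" "finite \<beta>" "\<beta> \<noteq> {}" if "\<beta> \<in> index_sets ?r N" for \<beta>
    using that pos r finite_subset[of \<beta> "{..<N}"] unfolding index_sets_def P_def by auto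
  have g: "?G $$ (a, b) = ?g a b" if "\<beta> \<subseteq> {..<N}" "a \<in> \<beta>" "b \<in> \<beta>" for a b \<beta>
    using that by (subst index_gram) (auto simp: dims)
  have col: "col (ctranspose P * ?Mk) j $ t = c j t" if "j < N" "t < N" for j t
    using that dims unfolding c_def
    by (subst index_col) (auto simp del: index_mult_mat(1) simp: index_mult_sum)
  have d0: "?d > 0" using sum_principal_minors_pos[of P] by (simp add: dims)
  have cdet: "cdet \<beta> t (replace_col ?G (col (ctranspose P * ?Mk) j) t) = cramer ?g \<beta> t (c j)"
    if j: "j < N" and \<beta>: "\<beta> \<in> index_sets_at ?r N t" for \<beta> t j
  proof -
    have b: "\<beta> \<subseteq> {..<N}" "t \<in> \<beta>" using \<beta> sets unfolding index_sets_at_def by auto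
    have "cdet \<beta> t (replace_col ?G (col (ctranspose P * ?Mk) j) t) =
        cramer ?g \<beta> t (\<lambda>x. col (ctranspose P * ?Mk) j $ x)"
      by (rule cdet_replace_col[OF b G hermitian_gram g[OF b(1)]])
    also have "\<dots> = cramer ?g \<beta> t (c j)" unfolding cramer_def
    proof (rule sum.cong)
      fix p assume "p \<in> arrangements (\<beta> - {t})"
      then have "set (t # p) \<subseteq> {..<N}" using b unfolding arrangements_def by auto
      then have "last (t # p) < N" using last_in_set[of "t # p"] by blast
      then show "((- 1) ^ length p * cycle_det ?g (\<beta> - {t} - set p)) *\<^sub>R
            (walk_prod ?g (t # p) * col (ctranspose P * ?Mk) j $ last (t # p)) =
          ((- 1) ^ length p * cycle_det ?g (\<beta> - {t} - set p)) *\<^sub>R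
            (walk_prod ?g (t # p) * c j (last (t # p)))"
        by (simp only: col[OF j])
    qed simp
    finally show ?thesis .
  qed
  have "mat N N (\<lambda>(i, j). drazin_entry1 k M i j) = ?Mk * X"
  proof (rule eq_matI)
    fix i j assume "i < dim_row (?Mk * X)" "j < dim_col (?Mk * X)"
    then have ij: "i < N" "j < N" using Mk X by auto
    have hd: "(\<Sum>\<beta>\<in>index_sets ?r N. hdet \<beta> ?G) = ?d"
      by (intro sum.cong refl hdet_eq_cycle_det hermitian_gram g) (use sets in auto)
    have "drazin_entry1 k M i j = (\<Sum>t<N. ?Mk $$ (i, t) * x j t) / of_real ?d"
      unfolding drazin_entry1_def Let_def P_def[symmetric] dims r[folded P_def] hd x_def
      using cdet[OF ij(2)] by simp
    also have "\<dots> = (\<Sum>t<N. ?Mk $$ (i, t) * X $$ (t, j))"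
      unfolding divide_of_real_quat X_def using ij by (simp add: scaleR_sum_right)
    also have "\<dots> = (?Mk * X) $$ (i, j)"
      using ij dims X by (subst index_mult_sum) auto
    finally show "mat N N (\<lambda>(i, j). drazin_entry1 k M i j) $$ (i, j) = (?Mk * X) $$ (i, j)"
      using ij by simp
  qed (use Mk X in auto)
  moreover have "?G * X = ctranspose P * ?Mk"
  proof (rule eq_matI)
    fix u j assume "u < dim_row (ctranspose P * ?Mk)" "j < dim_col (ctranspose P * ?Mk)"
    then have uj: "u < N" "j < N" using dims by auto
    have "(?G * X) $$ (u, j) = (\<Sum>t<N. ?g u t * inverse ?d *\<^sub>R x j t)"
      using uj G X dims g[of "{..<N}" u] by (subst index_mult_sum) (auto simp: X_def)
    also have "\<dots> = inverse ?d *\<^sub>R (\<Sum>t<N. ?g u t * x j t)"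
      by (simp add: scaleR_sum_right)
    also have "(\<Sum>t<N. ?g u t * x j t) = ?d *\<^sub>R c j u"
      using cramer_rank_solution[of u P "\<lambda>i. ?Mk $$ (i, j)"] uj
      unfolding x_def c_def dims by simp
    also have "inverse ?d *\<^sub>R ?d *\<^sub>R c j u = c j u" using d0 by simp
    also have "c j u = (ctranspose P * ?Mk) $$ (u, j)"
      unfolding c_def using uj dims by (subst index_mult_sum) auto
    finally show "(?G * X) $$ (u, j) = (ctranspose P * ?Mk) $$ (u, j)" .
  qed (use dims X in auto)
  ultimately show ?thesis using X by blast
qed

text \<open>\<open>P P\<^sup>*\<close> is the Gram matrix of \<open>P\<^sup>*\<close>, and \<open>P\<^sup>*\<close> is the corresponding power of \<open>M\<^sup>*\<close>. This reduces
all statements about the second expression to the first.\<close>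
lemma drazin_entry2_eq_qcnj:
  assumes M: "M \<in> carrier_mat N N" and r: "qrank (ctranspose M ^\<^sub>m k) = qrank (M ^\<^sub>m k)"
    and ij: "i < N" "j < N"
  shows "drazin_entry2 k M i j = qcnj (drazin_entry1 k (ctranspose M) j i)"
proof -
  let ?P = "M ^\<^sub>m (2 * k + 1)" and ?Mk = "M ^\<^sub>m k"
  let ?G = "?P * ctranspose ?P" and ?r = "qrank (M ^\<^sub>m k)"
  let ?b = "row (?Mk * ctranspose ?P) i" and ?b' = "col (?P * ctranspose ?Mk) i"
  let ?g = "gram N (entry (ctranspose ?P))"
  have P: "?P \<in> carrier_mat N N" and Mk: "?Mk \<in> carrier_mat N N"
    using M by (auto intro: pow_carrier_mat)
  then have dims: "dim_row ?P = N" "dim_col ?P = N" "dim_row ?Mk = N" "dim_col ?Mk = N"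
    "dim_row M = N" "dim_col M = N" using M by auto
  have b: "?b' $ x = qcnj (?b $ x)" if "x < N" for x
  proof -
    have "?P * ctranspose ?Mk = ctranspose (?Mk * ctranspose ?P)"
      using ctranspose_mult[OF Mk, of "ctranspose ?P" N] P by simp
    then have "?b' $ x = ctranspose (?Mk * ctranspose ?P) $$ (x, i)"
      using that ij dims by (subst index_col) auto
    also have "\<dots> = qcnj ((?Mk * ctranspose ?P) $$ (i, x))"
      using that ij dims by (subst index_ctranspose) auto
    finally show ?thesis using that ij dims by simp
  qed
  have g: "?G $$ (x, y) = ?g x y" if "x < N" "y < N" for x y
    using index_gram[of x "ctranspose ?P" y] that dims by simp
  have rdet: "rdet \<alpha> s (replace_row ?G ?b s) = qcnj (cdet \<alpha> s (replace_col ?G ?b' s))"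
    if "\<alpha> \<in> index_sets_at ?r N s" for \<alpha> s
  proof -
    have \<alpha>: "\<alpha> \<subseteq> {..<N}" "s \<in> \<alpha>" using that unfolding index_sets_at_def index_sets_def by auto
    have "?G \<in> carrier_mat N N" using P by simp
    moreover have "?G $$ (x, y) = ?g x y" if "x \<in> \<alpha>" "y \<in> \<alpha>" for x y
      by (rule g) (use that \<alpha> in auto)
    moreover have "?b' $ x = qcnj (?b $ x)" if "x \<in> \<alpha>" for x
      by (rule b) (use that \<alpha> in auto)
    ultimately show ?thesis
      by (rule rdet_replace_row[OF \<alpha> _ hermitian_gram])
  qed
  have "qcnj (drazin_entry1 k (ctranspose M) j i) = qcnj ((\<Sum>t<N. ctranspose ?Mk $$ (j, t) *
      (\<Sum>\<beta>\<in>index_sets_at ?r N t. cdet \<beta> t (replace_col ?G ?b' t))) /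
      of_real (\<Sum>\<beta>\<in>index_sets ?r N. hdet \<beta> ?G))"
    unfolding drazin_entry1_def Let_def r
    unfolding ctranspose_pow[OF M, symmetric] dim_ctranspose dims ctranspose_ctranspose ..
  also have "\<dots> = (\<Sum>t<N. (\<Sum>\<beta>\<in>index_sets_at ?r N t. rdet \<beta> t (replace_row ?G ?b t)) * ?Mk $$ (t, j)) /
      of_real (\<Sum>\<beta>\<in>index_sets ?r N. hdet \<beta> ?G)"
    unfolding divide_of_real_quat qcnj_scaleR qcnj_sum qcnj_mult
  proof (intro arg_cong[of _ _ "scaleR _"] sum.cong refl arg_cong2[of _ _ _ _ "(*)"])
    fix t assume "t \<in> {..<N}"
    then have t: "t < N" by simp
    show "qcnj (cdet \<beta> t (replace_col ?G ?b' t)) = rdet \<beta> t (replace_row ?G ?b t)"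
      if "\<beta> \<in> index_sets_at ?r N t" for \<beta>
      using rdet[OF that] by (rule sym)
    have "ctranspose ?Mk $$ (j, t) = qcnj (?Mk $$ (t, j))"
      by (rule index_ctranspose) (use t ij dims in simp_all)
    then show "qcnj (ctranspose ?Mk $$ (j, t)) = ?Mk $$ (t, j)" by (simp only: qcnj_qcnj)
  qed
  also have "\<dots> = drazin_entry2 k M i j"
    unfolding drazin_entry2_def Let_def dims ..
  finally show ?thesis ..
qed

section \<open>Rank, kernels and factorizations of matrix products\<close>

text \<open>With premises about dimensions, the simplifier can discharge them for compound factors and so
normalizes products.\<close>
lemma mult_mat_assoc_dims:
  "dim_col A = dim_row B \<Longrightarrow> dim_col B = dim_row C \<Longrightarrow> A * B * C = A * (B * C)"
  for A :: "'a::semiring_0 mat"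
  by (rule assoc_mult_mat[of A "dim_row A" "dim_col A" B "dim_col B" C "dim_col C"])
    (auto intro: carrier_matI)

lemma sum_mult_mat_entries:
  fixes A :: "'a::semiring_0 mat"
  assumes "A \<in> carrier_mat a b" and "B \<in> carrier_mat b c" and "i < a" and "S \<subseteq> {..<c}"
  shows "(\<Sum>t\<in>S. (A * B) $$ (i, t) * y t) = (\<Sum>l<b. A $$ (i, l) * (\<Sum>t\<in>S. B $$ (l, t) * y t))"
proof -
  have "(\<Sum>t\<in>S. (A * B) $$ (i, t) * y t) = (\<Sum>t\<in>S. \<Sum>l<b. A $$ (i, l) * (B $$ (l, t) * y t))"
  proof (rule sum.cong)
    fix t assume "t \<in> S"
    then have "(A * B) $$ (i, t) = (\<Sum>l<b. A $$ (i, l) * B $$ (l, t))"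
      using assms by (subst index_mult_sum) auto
    then show "(A * B) $$ (i, t) * y t = (\<Sum>l<b. A $$ (i, l) * (B $$ (l, t) * y t))"
      by (simp only: sum_distrib_right mult.assoc)
  qed simp
  then show ?thesis
    by (subst (asm) sum.swap) (simp only: sum_distrib_left)
qed

lemma indep_cols_of_product:
  assumes A: "A \<in> carrier_mat a b" and B: "B \<in> carrier_mat b c" and \<beta>: "\<beta> \<subseteq> {..<c}"
    and ind: "indep_cols a (entry (A * B)) \<beta>"
  shows "indep_cols b (entry B) \<beta>"
  unfolding indep_cols_def
proof (intro allI impI ballI)
  fix y t assume y: "\<forall>i<b. (\<Sum>t\<in>\<beta>. B $$ (i, t) * y t) = 0" and t: "t \<in> \<beta>"
  show "y t = 0"
    by (rule indep_colsD[OF ind _ t]) (simp only: sum_mult_mat_entries[OF A B _ \<beta>], simp add: y)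
qed

lemma qrank_mult_le_right:
  assumes A: "A \<in> carrier_mat a b" and B: "B \<in> carrier_mat b c"
  shows "qrank (A * B) \<le> qrank B"
proof -
  obtain \<beta> where \<beta>: "\<beta> \<subseteq> {..<dim_col (A * B)}" "indep_cols (dim_row (A * B)) (entry (A * B)) \<beta>"
    "card \<beta> = qrank (A * B)"
    "\<forall>s<dim_col (A * B). \<exists>y. \<forall>i<dim_row (A * B). (A * B) $$ (i, s) = (\<Sum>t\<in>\<beta>. (A * B) $$ (i, t) * y t)"
    by (rule exists_column_basis[of "A * B"])
  then have "indep_cols b (entry B) \<beta>"
    using indep_cols_of_product[OF A B, of \<beta>] A B by simp
  then show ?thesis
    using card_indep_cols_le_qrank[of \<beta> B] \<beta>(1,3) B by simp
qed

lemma qrank_mult_le_left: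
  assumes A: "A \<in> carrier_mat a b" and B: "B \<in> carrier_mat b c"
  shows "qrank (A * B) \<le> qrank A"
proof -
  obtain \<beta> where \<beta>: "\<beta> \<subseteq> {..<dim_col (A * B)}" "indep_cols (dim_row (A * B)) (entry (A * B)) \<beta>"
    "card \<beta> = qrank (A * B)"
    "\<forall>s<dim_col (A * B). \<exists>y. \<forall>i<dim_row (A * B). (A * B) $$ (i, s) = (\<Sum>t\<in>\<beta>. (A * B) $$ (i, t) * y t)"
    by (rule exists_column_basis[of "A * B"])
  obtain \<gamma> where \<gamma>: "\<gamma> \<subseteq> {..<dim_col A}" "indep_cols (dim_row A) (entry A) \<gamma>"
    "card \<gamma> = qrank A"
    "\<forall>s<dim_col A. \<exists>y. \<forall>i<dim_row A. A $$ (i, s) = (\<Sum>t\<in>\<gamma>. A $$ (i, t) * y t)"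
    by (rule exists_column_basis[of A])
  then obtain y where y: "\<And>s i. s < b \<Longrightarrow> i < a \<Longrightarrow> A $$ (i, s) = (\<Sum>t\<in>\<gamma>. A $$ (i, t) * y s t)"
    using A by (metis carrier_matD)
  have "(A * B) $$ (i, s) = (\<Sum>t\<in>\<gamma>. A $$ (i, t) * (\<Sum>l<b. y l t * B $$ (l, s)))"
    if "i < a" "s < c" for i s
  proof -
    have "(A * B) $$ (i, s) = (\<Sum>l<b. A $$ (i, l) * B $$ (l, s))"
      using that A B by (subst index_mult_sum) auto
    also have "\<dots> = (\<Sum>l<b. \<Sum>t\<in>\<gamma>. A $$ (i, t) * (y l t * B $$ (l, s)))"
    proof (rule sum.cong)
      fix l assume "l \<in> {..<b}"
      then have "A $$ (i, l) = (\<Sum>t\<in>\<gamma>. A $$ (i, t) * y l t)" using y that by simp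
      then show "A $$ (i, l) * B $$ (l, s) = (\<Sum>t\<in>\<gamma>. A $$ (i, t) * (y l t * B $$ (l, s)))"
        by (simp only: sum_distrib_right mult.assoc)
    qed simp
    also have "\<dots> = (\<Sum>t\<in>\<gamma>. A $$ (i, t) * (\<Sum>l<b. y l t * B $$ (l, s)))"
      by (subst sum.swap) (simp only: sum_distrib_left)
    finally show ?thesis .
  qed
  then have "card \<beta> \<le> card \<gamma>"
    by (intro card_indep_cols_le[OF \<beta>(2), of \<gamma> "entry A" "\<lambda>t s. \<Sum>l<b. y l t * B $$ (l, s)"])
      (use \<beta>(1) A B finite_subset[OF \<beta>(1)] finite_subset[OF \<gamma>(1)] in auto)
  then show ?thesis using \<beta>(3) \<gamma>(3) by simp
qed

text \<open>A set of independent columns of \<open>A * B\<close> of maximal size is also independent for \<open>B\<close>, and by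
equality of ranks it is a basis there too. Thus \<open>A\<close> is injective on the range of \<open>B\<close>.\<close>
lemma cancel_left_of_qrank_eq:
  assumes A: "A \<in> carrier_mat a b" and B: "B \<in> carrier_mat b c"
    and Y: "Y \<in> carrier_mat c d" and Z: "Z \<in> carrier_mat c d"
    and rank: "qrank (A * B) = qrank B" and eq: "A * B * Y = A * B * Z"
  shows "B * Y = B * Z"
proof -
  obtain \<beta> where \<beta>: "\<beta> \<subseteq> {..<dim_col (A * B)}" "indep_cols (dim_row (A * B)) (entry (A * B)) \<beta>"
    "card \<beta> = qrank (A * B)"
    "\<forall>s<dim_col (A * B). \<exists>y. \<forall>i<dim_row (A * B). (A * B) $$ (i, s) = (\<Sum>t\<in>\<beta>. (A * B) $$ (i, t) * y t)"
    by (rule exists_column_basis[of "A * B"])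
  then have \<beta>c: "\<beta> \<subseteq> {..<c}" and ind: "indep_cols a (entry (A * B)) \<beta>" using A B by auto
  have indB: "indep_cols b (entry B) \<beta>" by (rule indep_cols_of_product[OF A B \<beta>c ind])
  have "\<exists>y. \<forall>i<b. B $$ (i, s) = (\<Sum>t\<in>\<beta>. B $$ (i, t) * y t)" if "s < c" for s
    using indep_cols_of_full_card_span[of \<beta> B s] \<beta>c indB \<beta>(3) rank B that by auto
  then obtain y where y: "\<And>s i. s < c \<Longrightarrow> i < b \<Longrightarrow> B $$ (i, s) = (\<Sum>t\<in>\<beta>. B $$ (i, t) * y s t)"
    by metis
  show ?thesis
  proof (rule eq_matI)
    fix i j assume "i < dim_row (B * Z)" "j < dim_col (B * Z)"
    then have ij: "i < b" "j < d" using B Z by auto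
    define z where "z s = Y $$ (s, j) - Z $$ (s, j)" for s
    define w where "w t = (\<Sum>s<c. y s t * z s)" for t
    have Bz: "(\<Sum>s<c. B $$ (l, s) * z s) = (\<Sum>t\<in>\<beta>. B $$ (l, t) * w t)" if "l < b" for l
    proof -
      have "(\<Sum>s<c. B $$ (l, s) * z s) = (\<Sum>s<c. \<Sum>t\<in>\<beta>. B $$ (l, t) * (y s t * z s))"
      proof (rule sum.cong)
        fix s assume "s \<in> {..<c}"
        then have "B $$ (l, s) = (\<Sum>t\<in>\<beta>. B $$ (l, t) * y s t)" using y that by simp
        then show "B $$ (l, s) * z s = (\<Sum>t\<in>\<beta>. B $$ (l, t) * (y s t * z s))"
          by (simp only: sum_distrib_right mult.assoc)
      qed simp
      also have "\<dots> = (\<Sum>t\<in>\<beta>. B $$ (l, t) * w t)"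
        unfolding w_def by (subst sum.swap) (simp only: sum_distrib_left)
      finally show ?thesis .
    qed
    have diff: "(\<Sum>s<c. C $$ (l, s) * z s) = (C * Y) $$ (l, j) - (C * Z) $$ (l, j)"
      if "C \<in> carrier_mat e c" "l < e" for C l e
    proof -
      have "(C * Y) $$ (l, j) = (\<Sum>s<c. C $$ (l, s) * Y $$ (s, j))"
        "(C * Z) $$ (l, j) = (\<Sum>s<c. C $$ (l, s) * Z $$ (s, j))"
        using that Y Z ij by (subst index_mult_sum; auto)+
      then show ?thesis by (simp only: z_def right_diff_distrib sum_subtractf)
    qed
    have "(\<Sum>t\<in>\<beta>. (A * B) $$ (l, t) * w t) = 0" if "l < a" for l
    proof -
      have "(\<Sum>t\<in>\<beta>. (A * B) $$ (l, t) * w t) = (\<Sum>s<c. (A * B) $$ (l, s) * z s)"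
        unfolding sum_mult_mat_entries[OF A B that \<beta>c] sum_mult_mat_entries[OF A B that subset_refl]
        by (simp add: Bz)
      also have "\<dots> = 0" using diff[of "A * B" a l] A B that eq by simp
      finally show ?thesis .
    qed
    from indep_colsD[OF ind, of w, OF this] have "w t = 0" if "t \<in> \<beta>" for t using that by blast
    then have "(\<Sum>s<c. B $$ (i, s) * z s) = 0" using Bz[OF ij(1)] by simp
    then show "(B * Y) $$ (i, j) = (B * Z) $$ (i, j)" using diff[OF B ij(1)] by simp
  qed (use B Y Z in auto)
qed

lemma cancel_ctranspose:
  assumes P: "P \<in> carrier_mat a b" and Y: "Y \<in> carrier_mat b d" and Z: "Z \<in> carrier_mat b d"
    and eq: "ctranspose P * P * Y = ctranspose P * P * Z"
  shows "P * Y = P * Z"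
proof (rule eq_matI)
  fix i j assume "i < dim_row (P * Z)" "j < dim_col (P * Z)"
  then have ij: "i < a" "j < d" using P Z by auto
  define z where "z s = Y $$ (s, j) - Z $$ (s, j)" for s
  let ?G = "ctranspose P * P"
  have diff: "(\<Sum>s<b. C $$ (l, s) * z s) = (C * Y) $$ (l, j) - (C * Z) $$ (l, j)"
    if "C \<in> carrier_mat e b" "l < e" for C l e
  proof -
    have "(C * Y) $$ (l, j) = (\<Sum>s<b. C $$ (l, s) * Y $$ (s, j))"
      "(C * Z) $$ (l, j) = (\<Sum>s<b. C $$ (l, s) * Z $$ (s, j))"
      using that Y Z ij by (subst index_mult_sum; auto)+
    then show ?thesis by (simp only: z_def right_diff_distrib sum_subtractf)
  qed
  have G: "?G \<in> carrier_mat b b" by (rule mult_carrier_mat[OF ctranspose_carrier[OF P] P])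
  have "(\<Sum>s<b. gram a (entry P) t s * z s) = 0" if "t \<in> {..<b}" for t
  proof -
    have "(\<Sum>s<b. gram a (entry P) t s * z s) = (\<Sum>s<b. ?G $$ (t, s) * z s)"
      by (rule sum.cong) (use P that index_gram[of t P] in auto)
    also have "\<dots> = 0" using diff[OF G, of t] that eq by simp
    finally show ?thesis .
  qed
  from gram_kernel[OF this ij(1)] have "(\<Sum>s<b. P $$ (i, s) * z s) = 0" by simp
  then show "(P * Y) $$ (i, j) = (P * Z) $$ (i, j)" using diff[OF P ij(1)] by simp
qed (use P Y Z in auto)

text \<open>The columns of \<open>X\<close> are the normalized Cramer solutions for the unit vectors.\<close>
lemma exists_normal_equation_solution:
  assumes P: "P \<in> carrier_mat a b"
  shows "\<exists>X\<in>carrier_mat b a. ctranspose P * P * X = ctranspose P"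
proof -
  let ?g = "gram a (entry P)" and ?r = "qrank P"
  let ?d = "\<Sum>\<beta>\<in>index_sets ?r b. cycle_det ?g \<beta>"
  have dims: "dim_row P = a" "dim_col P = b" using P by auto
  \<comment> \<open>Unit right-hand sides: the conjugate transpose of \<open>P\<close> maps them to its own columns.\<close>
  define w where "w j i = (if i = j then 1 else 0 :: quat)" for i j :: nat
  define x where "x j t = (\<Sum>\<beta>\<in>index_sets_at ?r b t.
    cramer ?g \<beta> t (\<lambda>t. \<Sum>i<a. qcnj (P $$ (i, t)) * w j i))" for j t
  define X where "X = mat b a (\<lambda>(t, j). inverse ?d *\<^sub>R x j t)"
  have d0: "?d > 0" using sum_principal_minors_pos[of P] by (simp add: dims)
  have "ctranspose P * P * X = ctranspose P"
  proof (rule eq_matI)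
    fix u j assume "u < dim_row (ctranspose P)" "j < dim_col (ctranspose P)"
    then have uj: "u < b" "j < a" using dims by auto
    have "(ctranspose P * P * X) $$ (u, j) = (\<Sum>t<b. (ctranspose P * P) $$ (u, t) * X $$ (t, j))"
      using uj dims by (subst index_mult_sum) (auto simp: X_def)
    also have "\<dots> = inverse ?d *\<^sub>R (\<Sum>t<b. ?g u t * x j t)"
      unfolding scaleR_sum_right
      by (rule sum.cong) (use uj dims index_gram[of u P] in \<open>auto simp: X_def\<close>)
    also have "(\<Sum>t<b. ?g u t * x j t) = ?d *\<^sub>R (\<Sum>i<a. qcnj (P $$ (i, u)) * w j i)"
      using cramer_rank_solution[of u P "w j"] uj unfolding x_def dims by simp
    also have "(\<Sum>i<a. qcnj (P $$ (i, u)) * w j i) = ctranspose P $$ (u, j)"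
      using uj dims unfolding w_def by (simp add: sum_delta_right)
    finally show "(ctranspose P * P * X) $$ (u, j) = ctranspose P $$ (u, j)" using d0 by simp
  qed (auto simp: X_def dims)
  then show ?thesis by (intro bexI[of _ X]) (auto simp: X_def)
qed

text \<open>The hypothesis says that the kernel of \<open>B\<close> is contained in that of \<open>A\<close>. A solution \<open>X\<close> of the normal
equation satisfies \<open>B X B = B\<close>, so \<open>A X B = A\<close>.\<close>
lemma factor_right:
  fixes A B :: "quat mat"
  assumes A: "A \<in> carrier_mat a N" and B: "B \<in> carrier_mat b N"
    and cancel: "\<And>Y Z. Y \<in> carrier_mat N N \<Longrightarrow> Z \<in> carrier_mat N N \<Longrightarrow> B * Y = B * Z \<Longrightarrow> A * Y = A * Z"
  shows "\<exists>Y\<in>carrier_mat a b. A = Y * B"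
proof -
  obtain X where X: "X \<in> carrier_mat N b" "ctranspose B * B * X = ctranspose B"
    using exists_normal_equation_solution[OF B] by blast
  have XB: "X * B \<in> carrier_mat N N" using X B by simp
  have "ctranspose B * B * (X * B) = ctranspose B * B * X * B"
    using X B by (subst mult_mat_assoc_dims[of "ctranspose B * B"]) auto
  also have "\<dots> = ctranspose B * B * 1\<^sub>m N" unfolding X(2) using B by simp
  finally have "B * (X * B) = B * 1\<^sub>m N"
    by (intro cancel_ctranspose[OF B XB]) auto
  then have "A * (X * B) = A * 1\<^sub>m N" by (intro cancel XB) auto
  then have "A = A * X * B" using A B X by (simp add: mult_mat_assoc_dims)
  then show ?thesis using A X by (intro bexI[of _ "A * X"]) auto
qed

text \<open>From \<open>P\<^sup>* = P\<^sup>* P X\<close> the rank of \<open>P\<^sup>*\<close> is at most that of \<open>P\<close>; apply this to both.\<close>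
lemma qrank_ctranspose: "qrank (ctranspose P) = qrank P"
proof -
  have le: "qrank (ctranspose P) \<le> qrank P" for P
  proof -
    have P: "P \<in> carrier_mat (dim_row P) (dim_col P)" by simp
    obtain X where X: "X \<in> carrier_mat (dim_col P) (dim_row P)"
        "ctranspose P * P * X = ctranspose P"
      using exists_normal_equation_solution[OF P] by blast
    have "qrank (ctranspose P * P * X) \<le> qrank (ctranspose P * P)"
      by (rule qrank_mult_le_left[OF _ X(1)]) auto
    also have "\<dots> \<le> qrank P" by (rule qrank_mult_le_right[OF _ P]) auto
    finally show ?thesis unfolding X(2) .
  qed
  from le[of P] le[of "ctranspose P"] show ?thesis by simp
qed

lemma pow_mat_add:
  "M \<in> carrier_mat n n \<Longrightarrow> M ^\<^sub>m (a + b) = M ^\<^sub>m a * M ^\<^sub>m b" for M :: "'a::semiring_1 mat"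
proof (induction b)
  case (Suc b)
  then have "M ^\<^sub>m (a + Suc b) = M ^\<^sub>m a * M ^\<^sub>m b * M" by simp
  also have "\<dots> = M ^\<^sub>m a * (M ^\<^sub>m b * M)"
    using Suc.prems by (intro assoc_mult_mat[of _ n n _ n _ n]) simp_all
  finally show ?case by simp
qed simp

text \<open>Holds as soon as \<open>k\<close> is at least the index. This form is invariant under conjugate
transposition, so kernel statements turn into range statements, and it is exactly what the
determinantal expressions need.\<close>
definition powers_stable :: "nat \<Rightarrow> quat mat \<Rightarrow> bool" where
  "powers_stable k M \<longleftrightarrow> qrank (M ^\<^sub>m (2 * k + 1)) = qrank (M ^\<^sub>m k)"

lemma powers_stable_cancel:
  assumes M: "M \<in> carrier_mat N N" and "powers_stable k M"
    and Y: "Y \<in> carrier_mat N d" and Z: "Z \<in> carrier_mat N d"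
    and eq: "M ^\<^sub>m (2 * k + 1) * Y = M ^\<^sub>m (2 * k + 1) * Z"
  shows "M ^\<^sub>m k * Y = M ^\<^sub>m k * Z"
proof -
  have split: "M ^\<^sub>m (2 * k + 1) = M ^\<^sub>m (k + 1) * M ^\<^sub>m k"
    using pow_mat_add[OF M, of "k + 1" k] by (simp add: mult_2 add.commute add.left_commute del: pow_mat.simps)
  have "qrank (M ^\<^sub>m (k + 1) * M ^\<^sub>m k) = qrank (M ^\<^sub>m k)"
    using assms(2) unfolding powers_stable_def split .
  from cancel_left_of_qrank_eq[OF _ _ Y Z this eq[unfolded split]] M show ?thesis
    by (meson pow_carrier_mat)
qed

lemma powers_stable_ctranspose:
  "M \<in> carrier_mat N N \<Longrightarrow> powers_stable k M \<Longrightarrow> powers_stable k (ctranspose M)"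
  unfolding powers_stable_def by (simp only: ctranspose_pow[symmetric] qrank_ctranspose)

text \<open>The least exponent in the definition of the index exists because the ranks of the powers cannot
decrease forever.\<close>
lemma qrank_pow_mat_index:
  assumes M: "M \<in> carrier_mat N N"
  shows "qrank (M ^\<^sub>m (mat_index M + 1)) = qrank (M ^\<^sub>m mat_index M)"
  unfolding mat_index_def
proof (rule LeastI_ex, rule ccontr)
  assume ne: "\<nexists>k. qrank (M ^\<^sub>m (k + 1)) = qrank (M ^\<^sub>m k)"
  have "qrank (M ^\<^sub>m (k + 1)) < qrank (M ^\<^sub>m k)" for k
  proof -
    have "qrank (M * M ^\<^sub>m k) \<le> qrank (M ^\<^sub>m k)"
      by (rule qrank_mult_le_right[OF M pow_carrier_mat[OF M]])
    then have "qrank (M ^\<^sub>m (k + 1)) \<le> qrank (M ^\<^sub>m k)"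
      using pow_mat_Suc_left[OF M, of k] by simp
    with ne show ?thesis by (metis le_neq_implies_less)
  qed
  then have "qrank (M ^\<^sub>m k) + k \<le> qrank (M ^\<^sub>m 0)" for k
  proof (induction k)
    case (Suc k)
    from Suc.IH[OF Suc.prems] Suc.prems[of k] show ?case by simp
  qed simp
  from this[of "Suc (qrank (M ^\<^sub>m 0))"] show False by simp
qed

text \<open>From the index on all powers have the same kernel. So \<open>M ^\<^sub>m k\<close> factors through
\<open>M ^\<^sub>m (2 * k + 1)\<close>, which bounds its rank by that of the larger power.\<close>
lemma powers_stable_of_index_le:
  assumes M: "M \<in> carrier_mat N N" and k: "mat_index M \<le> k"
  shows "powers_stable k M"
proof -
  let ?j = "mat_index M"
  have Mc: "M ^\<^sub>m i \<in> carrier_mat N N" for i using M by simp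
  have step: "M ^\<^sub>m i * Y = M ^\<^sub>m i * Z"
    if "?j \<le> i" "M ^\<^sub>m Suc i * Y = M ^\<^sub>m Suc i * Z" "Y \<in> carrier_mat N N" "Z \<in> carrier_mat N N" for i Y Z
  proof -
    define e where "e = i - ?j"
    have i: "i = ?j + e" "Suc i = Suc ?j + e" using that(1) e_def by auto
    have "M ^\<^sub>m Suc i * W = M * M ^\<^sub>m ?j * (M ^\<^sub>m e * W) \<and> M ^\<^sub>m i * W = M ^\<^sub>m ?j * (M ^\<^sub>m e * W)"
      if W: "W \<in> carrier_mat N N" for W
      using assoc_mult_mat[OF Mc[of "Suc ?j"] Mc[of e] W] assoc_mult_mat[OF Mc[of ?j] Mc[of e] W]
        pow_mat_add[OF M, of "Suc ?j" e] pow_mat_add[OF M, of ?j e]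
      unfolding i(2) pow_mat_Suc_left[OF M, of ?j] by (simp only: i(1)[symmetric])
    then have "M * M ^\<^sub>m ?j * (M ^\<^sub>m e * Y) = M * M ^\<^sub>m ?j * (M ^\<^sub>m e * Z)"
      and goal: "M ^\<^sub>m i * Y = M ^\<^sub>m ?j * (M ^\<^sub>m e * Y)" "M ^\<^sub>m i * Z = M ^\<^sub>m ?j * (M ^\<^sub>m e * Z)"
      using that by metis+
    moreover have "qrank (M * M ^\<^sub>m ?j) = qrank (M ^\<^sub>m ?j)"
      using qrank_pow_mat_index[OF M] pow_mat_Suc_left[OF M, of ?j] by simp
    ultimately have "M ^\<^sub>m ?j * (M ^\<^sub>m e * Y) = M ^\<^sub>m ?j * (M ^\<^sub>m e * Z)"
      by (intro cancel_left_of_qrank_eq[OF M Mc, of _ N]) (use that M in auto)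
    then show ?thesis unfolding goal .
  qed
  have cancel: "M ^\<^sub>m k * Y = M ^\<^sub>m k * Z"
    if "M ^\<^sub>m (k + e) * Y = M ^\<^sub>m (k + e) * Z" "Y \<in> carrier_mat N N" "Z \<in> carrier_mat N N" for e Y Z
    using that(1)
  proof (induction e)
    case (Suc e)
    then show ?case using step[of "k + e" Y Z] k that(2,3) by simp
  qed simp
  have "\<exists>Y\<in>carrier_mat N N. M ^\<^sub>m k = Y * M ^\<^sub>m (2 * k + 1)"
    by (rule factor_right[OF Mc Mc], rule cancel[of "k + 1"]) (simp_all add: mult_2 add.assoc del: pow_mat.simps)
  then obtain Y where Y: "Y \<in> carrier_mat N N" "M ^\<^sub>m k = Y * M ^\<^sub>m (2 * k + 1)" by blast
  have "qrank (M ^\<^sub>m k) \<le> qrank (M ^\<^sub>m (2 * k + 1))"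
    by (subst Y(2)) (rule qrank_mult_le_right[OF Y(1) Mc])
  moreover have "M ^\<^sub>m (2 * k + 1) = M ^\<^sub>m (k + 1) * M ^\<^sub>m k"
    using pow_mat_add[OF M, of "k + 1" k] by (simp add: mult_2 add.commute add.left_commute del: pow_mat.simps)
  then have "qrank (M ^\<^sub>m (2 * k + 1)) \<le> qrank (M ^\<^sub>m k)"
    using qrank_mult_le_right[OF Mc Mc] by metis
  ultimately show ?thesis unfolding powers_stable_def by simp
qed

section \<open>The Drazin inverse\<close>

text \<open>Any \<open>k\<close> not below the index is admitted: the two matrices of the theorem share one \<open>k\<close>, although
their indices may differ.\<close>
definition is_drazin :: "nat \<Rightarrow> 'a::semiring_1 mat \<Rightarrow> 'a mat \<Rightarrow> bool" where
  "is_drazin k M E \<longleftrightarrow> E \<in> carrier_mat (dim_row M) (dim_row M) \<and>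
     M ^\<^sub>m (k + 1) * E = M ^\<^sub>m k \<and> M * E = E * M \<and> E * M * E = E"

lemma pow_mat_commute:
  assumes M: "M \<in> carrier_mat n n" and E: "E \<in> carrier_mat n n" and comm: "M * E = E * M"
  shows "M ^\<^sub>m j * E = E * M ^\<^sub>m j"
proof (induction j)
  case (Suc j)
  have Mj: "M ^\<^sub>m j \<in> carrier_mat n n" using M by simp
  have "M ^\<^sub>m Suc j * E = M ^\<^sub>m j * (M * E)"
    unfolding pow_mat.simps by (rule assoc_mult_mat[OF Mj M E])
  also have "\<dots> = M ^\<^sub>m j * E * M" unfolding comm by (rule assoc_mult_mat[OF Mj E M, symmetric])
  also have "\<dots> = E * (M ^\<^sub>m j * M)" unfolding Suc by (rule assoc_mult_mat[OF E Mj M])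
  finally show ?case by simp
qed (use M E in simp)

text \<open>Since \<open>E = M E E\<close>, arbitrary powers of \<open>M\<close> can be pulled out of \<open>E\<close> on both sides.\<close>
lemma is_drazin_factor:
  assumes M: "M \<in> carrier_mat n n" and E: "is_drazin k M E"
  shows "\<exists>W\<in>carrier_mat n n. E = M ^\<^sub>m j * W \<and> E = W * M ^\<^sub>m j"
proof (induction j)
  case 0
  then show ?case using M E by (intro bexI[of _ E]) (auto simp: is_drazin_def)
next
  case (Suc j)
  have Ec: "E \<in> carrier_mat n n" and comm: "M * E = E * M" and EME: "E * M * E = E"
    using E M by (auto simp: is_drazin_def)
  from Suc obtain W where W: "W \<in> carrier_mat n n" "E = M ^\<^sub>m j * W" "E = W * M ^\<^sub>m j" by blast
  note dims = carrier_matD[OF M] carrier_matD[OF Ec] carrier_matD[OF W(1)]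
  have "E = M * (E * E)" using EME comm by (simp add: dims flip: mult_mat_assoc_dims)
  also have "\<dots> = M * (M ^\<^sub>m j * W * E)" using W(2) by simp
  finally have left: "E = M ^\<^sub>m Suc j * (W * E)"
    unfolding pow_mat_Suc_left[OF M] by (simp add: dims mult_mat_assoc_dims del: pow_mat.simps)
  have "E = E * E * M" using EME comm by (simp add: dims mult_mat_assoc_dims)
  also have "\<dots> = E * (W * M ^\<^sub>m j) * M" using W(3) by simp
  finally have right: "E = (E * W) * M ^\<^sub>m Suc j" by (simp add: dims mult_mat_assoc_dims)
  have "E * W = W * E"
  proof -
    have "E * W = W * M ^\<^sub>m j * W" using W(3) by simp
    also have "\<dots> = W * E" using W(2) by (simp add: dims mult_mat_assoc_dims)
    finally show ?thesis .
  qed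
  with left right W Ec show ?case by (intro bexI[of _ "W * E"]) auto
qed

text \<open>Writing \<open>E = V M\<^sup>k\<close> gives \<open>E M F = E\<close>, and writing \<open>F = M\<^sup>k W\<close> gives \<open>E M F = F\<close>.\<close>
lemma is_drazin_unique:
  assumes M: "M \<in> carrier_mat n n" and E: "is_drazin k M E" and F: "is_drazin k M F"
  shows "E = F"
proof -
  have Ec: "E \<in> carrier_mat n n" and Fc: "F \<in> carrier_mat n n"
    and commE: "M * E = E * M" and powE: "M ^\<^sub>m (k + 1) * E = M ^\<^sub>m k" and powF: "M ^\<^sub>m (k + 1) * F = M ^\<^sub>m k"
    using E F M by (auto simp: is_drazin_def)
  obtain V where V: "V \<in> carrier_mat n n" "E = V * M ^\<^sub>m k"
    using is_drazin_factor[OF M E] by blast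
  obtain W where W: "W \<in> carrier_mat n n" "F = M ^\<^sub>m k * W"
    using is_drazin_factor[OF M F] by blast
  note dims = carrier_matD[OF M] carrier_matD[OF Ec] carrier_matD[OF Fc]
    carrier_matD[OF V(1)] carrier_matD[OF W(1)]
  have "E * (M * F) = V * (M ^\<^sub>m (k + 1) * F)"
    unfolding V(2) by (simp add: dims mult_mat_assoc_dims)
  also have "\<dots> = E" unfolding powF V(2)[symmetric] ..
  finally have 1: "E * (M * F) = E" .
  have "E * (M * F) = E * M ^\<^sub>m Suc k * W"
    unfolding W(2) pow_mat_Suc_left[OF M] by (simp add: dims mult_mat_assoc_dims del: pow_mat.simps)
  also have "\<dots> = M ^\<^sub>m (k + 1) * E * W"
    using pow_mat_commute[OF M Ec commE, of "Suc k"] by simp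
  also have "\<dots> = F" unfolding powE W(2)[symmetric] ..
  finally show ?thesis using 1 by simp
qed

text \<open>Stability of \<open>M\<^sup>*\<close> gives \<open>M\<^sup>k = P Y\<close>, so the normal equation \<open>P\<^sup>* P X = P\<^sup>* M\<^sup>k\<close> improves to
\<open>P X = M\<^sup>k\<close>. The Drazin equations for \<open>E = M\<^sup>k X\<close> then hold because both sides lie in the range of
\<open>M\<^sup>k\<close>, on which \<open>M\<^sup>k\<^sup>+\<^sup>1\<close> is injective, and agree after multiplication by \<open>M\<^sup>k\<^sup>+\<^sup>1\<close>.\<close>
theorem is_drazin_drazin_entry1:
  assumes M: "M \<in> carrier_mat N N" and stable: "powers_stable k M" and pos: "1 \<le> qrank (M ^\<^sub>m k)"
  shows "is_drazin k M (mat N N (\<lambda>(i, j). drazin_entry1 k M i j))"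
proof -
  define P where "P = M ^\<^sub>m (2 * k + 1)"
  define E where "E = mat N N (\<lambda>(i, j). drazin_entry1 k M i j)"
  let ?K = "M ^\<^sub>m k"
  have K: "?K \<in> carrier_mat N N" and P: "P \<in> carrier_mat N N" and K1: "M ^\<^sub>m (k + 1) \<in> carrier_mat N N"
    unfolding P_def by (rule pow_carrier_mat[OF M])+
  have split: "P = M ^\<^sub>m (k + 1) * ?K" unfolding P_def
    using pow_mat_add[OF M, of "k + 1" k] by (simp add: mult_2 add.commute add.left_commute del: pow_mat.simps)
  obtain X where X: "X \<in> carrier_mat N N" "E = ?K * X" "ctranspose P * P * X = ctranspose P * ?K"
    using drazin_entry1_normal_equation[OF M _ pos] stable
    unfolding powers_stable_def P_def E_def by metis
  have Ec: "E \<in> carrier_mat N N" unfolding E_def by simp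
  note dims = carrier_matD[OF M] carrier_matD[OF Ec] carrier_matD[OF X(1)] carrier_matD[OF K]
    carrier_matD[OF P] carrier_matD[OF K1]
  note stable' = powers_stable_ctranspose[OF M stable]
  have "\<exists>Y\<in>carrier_mat N N. ctranspose ?K = Y * ctranspose P"
  proof (rule factor_right[OF ctranspose_carrier[OF K] ctranspose_carrier[OF P]])
    fix Y Z assume "Y \<in> carrier_mat N N" "Z \<in> carrier_mat N N" "ctranspose P * Y = ctranspose P * Z"
    then show "ctranspose ?K * Y = ctranspose ?K * Z"
      using powers_stable_cancel[OF ctranspose_carrier[OF M] stable', of Y N Z]
      unfolding P_def ctranspose_pow[OF M] by blast
  qed
  then obtain Y where Y: "Y \<in> carrier_mat N N" "ctranspose ?K = Y * ctranspose P" by blast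
  have "?K = ctranspose (Y * ctranspose P)" using Y(2) by (metis ctranspose_ctranspose)
  then have range: "?K = P * ctranspose Y"
    by (simp only: ctranspose_mult[OF Y(1) ctranspose_carrier[OF P]] ctranspose_ctranspose)
  have "ctranspose P * P * X = ctranspose P * P * ctranspose Y"
    unfolding X(3) by (subst range, rule assoc_mult_mat[symmetric, of _ N N _ N _ N]) (use P Y in auto)
  then have "P * X = P * ctranspose Y"
    by (rule cancel_ctranspose[OF P X(1) ctranspose_carrier[OF Y(1)]])
  then have PX: "P * X = ?K" using range by simp
  have cancel: "?K * S = ?K * T"
    if "S \<in> carrier_mat N N" "T \<in> carrier_mat N N"
      and eq: "M ^\<^sub>m (k + 1) * (?K * S) = M ^\<^sub>m (k + 1) * (?K * T)" for S T
  proof (rule powers_stable_cancel[OF M stable that(1,2)])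
    show "M ^\<^sub>m (2 * k + 1) * S = M ^\<^sub>m (2 * k + 1) * T"
      unfolding P_def[symmetric] split assoc_mult_mat[OF K1 K that(1)] assoc_mult_mat[OF K1 K that(2)]
      by (rule eq)
  qed
  have powE: "M ^\<^sub>m (k + 1) * E = ?K"
    unfolding X(2) assoc_mult_mat[OF K1 K X(1), symmetric] split[symmetric] by (rule PX)
  have MK: "M * ?K = ?K * M" using pow_mat_Suc_left[OF M, of k] by simp
  have XM: "X * M \<in> carrier_mat N N" "M * X \<in> carrier_mat N N" using X(1) M by auto
  have EM: "E * M = ?K * (X * M)" unfolding X(2) by (rule assoc_mult_mat[OF K X(1) M])
  have ME: "M * E = ?K * (M * X)"
    unfolding X(2) assoc_mult_mat[OF M K X(1), symmetric] MK by (rule assoc_mult_mat[OF K M X(1)])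
  have "M ^\<^sub>m (k + 1) * (M * E) = M ^\<^sub>m (k + 1) * (E * M)"
  proof -
    have "M ^\<^sub>m (k + 1) * (M * E) = M * (M ^\<^sub>m (k + 1) * E)"
      using pow_mat_commute[OF M M refl, of "k + 1"] M K1 Ec
      by (simp only: assoc_mult_mat[OF K1 M Ec, symmetric] assoc_mult_mat[OF M K1 Ec, symmetric])
    also have "\<dots> = M ^\<^sub>m (k + 1) * E * M" unfolding powE MK ..
    also have "\<dots> = M ^\<^sub>m (k + 1) * (E * M)" by (rule assoc_mult_mat[OF K1 Ec M])
    finally show ?thesis .
  qed
  then have comm: "M * E = E * M"
    unfolding ME EM by (rule cancel[OF XM(2,1)])
  have ME_c: "M * E \<in> carrier_mat N N" using M Ec by simp
  have XME: "X * (M * E) \<in> carrier_mat N N" using X(1) ME_c by simp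
  have "E * (M * E) = ?K * (X * (M * E))"
    using assoc_mult_mat[OF K X(1) ME_c] unfolding X(2)[symmetric] .
  then have EME: "E * M * E = ?K * (X * (M * E))"
    unfolding assoc_mult_mat[OF Ec M Ec] .
  have "M ^\<^sub>m (k + 1) * (?K * (X * (M * E))) = M ^\<^sub>m (k + 1) * E"
  proof -
    have "M ^\<^sub>m (k + 1) * (?K * (X * (M * E))) = M ^\<^sub>m (k + 1) * (E * (M * E))"
      unfolding EME[symmetric] assoc_mult_mat[OF Ec M Ec] ..
    also have "\<dots> = ?K * (M * E)"
      unfolding assoc_mult_mat[OF K1 Ec ME_c, symmetric] powE ..
    also have "\<dots> = M ^\<^sub>m (k + 1) * E"
      unfolding assoc_mult_mat[OF K M Ec, symmetric] by simp
    finally show ?thesis .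
  qed
  then have "E * M * E = E" unfolding EME
    by (rule cancel[OF XME X(1), unfolded X(2)[symmetric]])
  with Ec powE comm show ?thesis unfolding is_drazin_def E_def[symmetric] dims by blast
qed

lemma is_drazin_ctranspose:
  assumes M: "M \<in> carrier_mat N N" and E: "is_drazin k (ctranspose M) E"
  shows "is_drazin k M (ctranspose E)"
proof -
  have Mc: "ctranspose M \<in> carrier_mat N N" using M by simp
  have Ec: "E \<in> carrier_mat N N" and comm: "ctranspose M * E = E * ctranspose M"
    and EME: "E * ctranspose M * E = E" and pow: "ctranspose M ^\<^sub>m (k + 1) * E = ctranspose M ^\<^sub>m k"
    using E M by (auto simp: is_drazin_def)
  have comm': "M * ctranspose E = ctranspose E * M"
    using arg_cong[OF comm, of ctranspose] ctranspose_mult[OF Mc Ec] ctranspose_mult[OF Ec Mc] by simp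
  have "ctranspose E * M ^\<^sub>m (k + 1) = M ^\<^sub>m k"
    using arg_cong[OF pow, of ctranspose] ctranspose_mult[OF pow_carrier_mat[OF Mc] Ec, of "k + 1"]
    by (simp only: ctranspose_pow[OF Mc] ctranspose_ctranspose)
  then have "M ^\<^sub>m (k + 1) * ctranspose E = M ^\<^sub>m k"
    using pow_mat_commute[OF M ctranspose_carrier[OF Ec] comm', of "k + 1"] by simp
  moreover have "ctranspose E * M * ctranspose E = ctranspose E"
  proof -
    have "ctranspose (E * ctranspose M * E) = ctranspose E * (M * ctranspose E)"
      using ctranspose_mult[OF mult_carrier_mat[OF Ec Mc] Ec] ctranspose_mult[OF Ec Mc] by simp
    then show ?thesis unfolding EME
      using assoc_mult_mat[OF ctranspose_carrier[OF Ec] M ctranspose_carrier[OF Ec]] by simp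
  qed
  ultimately show ?thesis using comm' Ec M unfolding is_drazin_def by auto
qed

theorem is_drazin_drazin_entry:
  assumes M: "M \<in> carrier_mat N N" and stable: "powers_stable k M" and pos: "1 \<le> qrank (M ^\<^sub>m k)"
  shows "is_drazin k M (mat N N (\<lambda>(i, j). drazin_entry l k M i j))"
proof (cases "l = 1")
  case True
  then show ?thesis using is_drazin_drazin_entry1[OF assms] by (simp add: drazin_entry_def)
next
  case False
  let ?F = "mat N N (\<lambda>(i, j). drazin_entry1 k (ctranspose M) i j)"
  have rank: "qrank (ctranspose M ^\<^sub>m k) = qrank (M ^\<^sub>m k)"
    by (simp only: ctranspose_pow[OF M, symmetric] qrank_ctranspose)
  have "is_drazin k (ctranspose M) ?F"
    by (rule is_drazin_drazin_entry1) (use M powers_stable_ctranspose[OF M stable] pos rank in auto)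
  then have "is_drazin k M (ctranspose ?F)" by (rule is_drazin_ctranspose[OF M])
  moreover have "ctranspose ?F = mat N N (\<lambda>(i, j). drazin_entry l k M i j)"
    by (rule eq_matI)
      (use False drazin_entry2_eq_qcnj[OF M rank] in \<open>auto simp: drazin_entry_def\<close>)
  ultimately show ?thesis by simp
qed

section \<open>The weighted Drazin inverse\<close>

lemma mult_pow_mat_shift:
  fixes A :: "'a::semiring_1 mat"
  assumes A: "A \<in> carrier_mat m n" and W: "W \<in> carrier_mat n m"
  shows "(A * W) ^\<^sub>m j * A = A * (W * A) ^\<^sub>m j"
proof (induction j)
  case (Suc j)
  note dims = carrier_matD[OF A] carrier_matD[OF W]
  have "(A * W) ^\<^sub>m Suc j * A = (A * W) ^\<^sub>m j * A * (W * A)"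
    by (simp add: dims mult_mat_assoc_dims)
  also have "\<dots> = A * (W * A) ^\<^sub>m Suc j"
    unfolding Suc by (simp add: dims mult_mat_assoc_dims)
  finally show ?case .
qed (use A W in simp)

text \<open>If \<open>X\<close> satisfies the weighted equations, then \<open>X W\<close> is a Drazin inverse of \<open>A W\<close> and
\<open>X = (X W)\<^sup>2 A\<close>; this gives uniqueness and the second formula. Existence is checked on
\<open>A E\<^sup>2\<close>, which by uniqueness gives the first formula.\<close>
theorem wdrazin_eq:
  assumes A: "A \<in> carrier_mat m n" and W: "W \<in> carrier_mat n m"
    and k: "k = max (mat_index (A * W)) (mat_index (W * A))"
    and E: "is_drazin k (W * A) E" and F: "is_drazin k (A * W) F"
  shows "wdrazin A W = A * (E * E)" and "wdrazin A W = F * F * A"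
proof -
  let ?U = "W * A" and ?V = "A * W"
  have U: "?U \<in> carrier_mat n n" and V: "?V \<in> carrier_mat m m" using A W by auto
  have Ec: "E \<in> carrier_mat n n" and commE: "?U * E = E * ?U" and EUE: "E * ?U * E = E"
    and powE: "?U ^\<^sub>m (k + 1) * E = ?U ^\<^sub>m k"
    using E A W unfolding is_drazin_def by auto
  have Fc: "F \<in> carrier_mat m m" and commF: "?V * F = F * ?V"
    and powF: "?V ^\<^sub>m (k + 1) * F = ?V ^\<^sub>m k"
    using F A W unfolding is_drazin_def by auto
  note dims = carrier_matD[OF A] carrier_matD[OF W] carrier_matD[OF Ec] carrier_matD[OF Fc]
  have unique: "X = F * F * A" if X: "is_wdrazin A W X" for X
  proof -
    have Xc: "X \<in> carrier_mat m n" and 1: "?V ^\<^sub>m (k + 1) * X * W = ?V ^\<^sub>m k"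
      and 2: "X * W * A * W * X = X" and 3: "A * W * X = X * W * A"
      using X A unfolding is_wdrazin_def Let_def k[symmetric] by auto
    note dims = dims carrier_matD[OF Xc]
    have "is_drazin k ?V (X * W)"
      unfolding is_drazin_def
    proof (intro conjI)
      show "X * W \<in> carrier_mat (dim_row ?V) (dim_row ?V)" using A W Xc by simp
      show "?V ^\<^sub>m (k + 1) * (X * W) = ?V ^\<^sub>m k"
        using 1 by (simp add: dims mult_mat_assoc_dims del: pow_mat.simps)
      have "?V * (X * W) = A * W * X * W" by (simp add: dims mult_mat_assoc_dims)
      also have "\<dots> = X * W * ?V" unfolding 3 by (simp add: dims mult_mat_assoc_dims)
      finally show "?V * (X * W) = X * W * ?V" .
      have "X * W * ?V * (X * W) = X * W * A * W * X * W" by (simp add: dims mult_mat_assoc_dims)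
      then show "X * W * ?V * (X * W) = X * W" unfolding 2 .
    qed
    then have XW: "X * W = F" using is_drazin_unique[OF V _ F] by blast
    have "X = X * W * (A * W * X)" using 2 by (simp add: dims mult_mat_assoc_dims)
    also have "\<dots> = X * W * (X * W * A)" unfolding 3 ..
    finally show ?thesis unfolding XW by (simp add: dims mult_mat_assoc_dims)
  qed
  have "is_wdrazin A W (A * (E * E))"
    unfolding is_wdrazin_def Let_def k[symmetric]
  proof (intro conjI)
    let ?X = "A * (E * E)"
    have Vj: "?V ^\<^sub>m j \<in> carrier_mat m m" and Uj: "?U ^\<^sub>m j \<in> carrier_mat n n" for j
      using U V by simp_all
    note dims = dims carrier_matD[OF Vj] carrier_matD[OF Uj]
    show "?X \<in> carrier_mat (dim_row A) (dim_col A)" using A Ec by simp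
    have UUE: "?U * (?U * (E * E)) = ?U * E"
    proof -
      have "?U * (?U * (E * E)) = ?U * (?U * E * E)"
        by (simp only: assoc_mult_mat[OF U Ec Ec])
      then show ?thesis unfolding commE EUE .
    qed
    have UEE: "?U * (E * E) = E"
      using EUE unfolding commE[symmetric] by (simp add: assoc_mult_mat[OF U Ec Ec])
    \<comment> \<open>One power of \<open>A W\<close> too many; multiplication by \<open>F\<close> removes it afterwards.\<close>
    have "?V ^\<^sub>m Suc (Suc k) * (?X * W) = ?V ^\<^sub>m Suc k"
    proof -
      have "?V ^\<^sub>m Suc (Suc k) * (?X * W) = ?V ^\<^sub>m Suc (Suc k) * A * (E * E) * W"
        using dims by (simp add: mult_mat_assoc_dims del: pow_mat.simps)
      also have "?V ^\<^sub>m Suc (Suc k) * A = A * ?U ^\<^sub>m Suc (Suc k)"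
        by (rule mult_pow_mat_shift[OF A W])
      also have "A * ?U ^\<^sub>m Suc (Suc k) * (E * E) = A * (?U ^\<^sub>m Suc k * (?U * (E * E)))"
        using dims by (simp add: mult_mat_assoc_dims)
      also have "\<dots> = A * ?U ^\<^sub>m k" unfolding UEE using powE by simp
      also have "\<dots> = ?V ^\<^sub>m k * A" by (rule mult_pow_mat_shift[OF A W, symmetric])
      also have "\<dots> * W = ?V ^\<^sub>m Suc k" using dims by (simp add: mult_mat_assoc_dims)
      finally show ?thesis .
    qed
    then have *: "F * (?V ^\<^sub>m Suc (Suc k) * (?X * W)) = F * ?V ^\<^sub>m Suc k" by simp
    have FV: "F * ?V ^\<^sub>m Suc k = ?V ^\<^sub>m k"
      using pow_mat_commute[OF V Fc commF, of "Suc k"] powF by simp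
    have "F * (?V ^\<^sub>m Suc (Suc k) * (?X * W)) = F * ?V ^\<^sub>m Suc k * (?V * (?X * W))"
      using dims by (simp add: mult_mat_assoc_dims)
    also have "\<dots> = ?V ^\<^sub>m (k + 1) * ?X * W"
      unfolding FV using dims by (simp add: mult_mat_assoc_dims)
    finally show "?V ^\<^sub>m (k + 1) * ?X * W = ?V ^\<^sub>m k" using * FV by simp
    have "?X * W * A * W * ?X = A * (E * (E * (?U * (?U * (E * E)))))"
      using dims by (simp add: mult_mat_assoc_dims)
    also have "\<dots> = A * (E * (E * (?U * E)))" unfolding UUE ..
    also have "E * (?U * E) = E" using EUE by (simp add: assoc_mult_mat[OF Ec U Ec])
    finally show "?X * W * A * W * ?X = ?X" .
    have "A * W * ?X = A * (?U * (E * E))" using dims by (simp add: mult_mat_assoc_dims)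
    also have "\<dots> = A * (E * E * ?U)"
    proof -
      have "E * E * ?U = E * (?U * E)" unfolding commE by (rule assoc_mult_mat[OF Ec Ec U])
      then show ?thesis unfolding UEE using EUE by (simp add: assoc_mult_mat[OF Ec U Ec])
    qed
    also have "\<dots> = ?X * W * A" using dims by (simp add: mult_mat_assoc_dims)
    finally show "A * W * ?X = ?X * W * A" .
  qed
  then have "wdrazin A W = A * (E * E) \<and> wdrazin A W = F * F * A"
    unfolding wdrazin_def using unique the_equality[of "is_wdrazin A W"] by metis
  then show "wdrazin A W = A * (E * E)" and "wdrazin A W = F * F * A" by blast+
qed

theorem mainTheorem6:
  fixes A W U V :: "quat mat" and m n k :: nat
  assumes "A \<in> carrier_mat m n" and "W \<in> carrier_mat n m"
    and "U = W * A" and "V = A * W"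
    and "k = max (mat_index (A * W)) (mat_index (W * A))"
    and "qrank (U ^\<^sub>m k) \<ge> 1" and "qrank (V ^\<^sub>m k) \<ge> 1"
  shows "wdrazin A W \<in> carrier_mat m n \<and>
    (\<forall>l\<in>{1, 2}. \<forall>f\<in>{1, 2}. \<forall>i<m. \<forall>j<n.
       wdrazin A W $$ (i, j) =
         (\<Sum>q<n. A $$ (i, q) *
            (\<Sum>p<n. drazin_entry l k U q p * drazin_entry f k U p j)) \<and>
       wdrazin A W $$ (i, j) =
         (\<Sum>q<m. (\<Sum>p<m. drazin_entry l k V i p * drazin_entry f k V p q) *
            A $$ (q, j)))"
proof -
  have U: "U \<in> carrier_mat n n" and V: "V \<in> carrier_mat m m" using assms(1-4) by auto
  define E where "E l = mat n n (\<lambda>(i, j). drazin_entry l k U i j)" for l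
  define F where "F l = mat m m (\<lambda>(i, j). drazin_entry l k V i j)" for l
  have "powers_stable k U" "powers_stable k V"
    using powers_stable_of_index_le[OF U] powers_stable_of_index_le[OF V] assms(3-5) by auto
  then have E: "is_drazin k U (E l)" and F: "is_drazin k V (F l)" for l
    unfolding E_def F_def using is_drazin_drazin_entry U V assms(6,7) by blast+
  have same: "E l = E f" "F l = F f" for l f
    using is_drazin_unique[OF U E E] is_drazin_unique[OF V F F] by blast+
  have eq: "wdrazin A W = A * (E l * E f)" "wdrazin A W = F l * F f * A" for l f
    using wdrazin_eq[OF assms(1,2,5), of "E l" "F l"] E F same[of l f] assms(3,4) by auto
  have carrier: "E l \<in> carrier_mat n n" "F l \<in> carrier_mat m m" for l
    unfolding E_def F_def by simp_all
  have "wdrazin A W $$ (i, j) =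
      (\<Sum>q<n. A $$ (i, q) * (\<Sum>p<n. drazin_entry l k U q p * drazin_entry f k U p j)) \<and>
    wdrazin A W $$ (i, j) =
      (\<Sum>q<m. (\<Sum>p<m. drazin_entry l k V i p * drazin_entry f k V p q) * A $$ (q, j))"
    if ij: "i < m" "j < n" for l f i j
  proof
    have "wdrazin A W $$ (i, j) = (\<Sum>q<n. A $$ (i, q) * (E l * E f) $$ (q, j))"
      unfolding eq(1)[of l f] using ij assms(1) carrier[of l] carrier[of f] by (subst index_mult_sum) auto
    also have "\<dots> = (\<Sum>q<n. A $$ (i, q) * (\<Sum>p<n. E l $$ (q, p) * E f $$ (p, j)))"
      by (intro sum.cong refl arg_cong2[of _ _ _ _ "(*)"], subst index_mult_sum)
        (use ij carrier[of l] carrier[of f] in auto)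
    finally show "wdrazin A W $$ (i, j) =
        (\<Sum>q<n. A $$ (i, q) * (\<Sum>p<n. drazin_entry l k U q p * drazin_entry f k U p j))"
      unfolding E_def using ij by simp
    have "wdrazin A W $$ (i, j) = (\<Sum>q<m. (F l * F f) $$ (i, q) * A $$ (q, j))"
      unfolding eq(2)[of l f] using ij assms(1) carrier[of l] carrier[of f] by (subst index_mult_sum) auto
    also have "\<dots> = (\<Sum>q<m. (\<Sum>p<m. F l $$ (i, p) * F f $$ (p, q)) * A $$ (q, j))"
      by (intro sum.cong refl arg_cong2[of _ _ _ _ "(*)"], subst index_mult_sum)
        (use ij carrier[of l] carrier[of f] in auto)
    finally show "wdrazin A W $$ (i, j) =
        (\<Sum>q<m. (\<Sum>p<m. drazin_entry l k V i p * drazin_entry f k V p q) * A $$ (q, j))"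
      unfolding F_def using ij by simp
  qed
  moreover have "wdrazin A W \<in> carrier_mat m n"
    unfolding eq(1)[of 1 1] using assms(1) carrier[of 1] by auto
  ultimately show ?thesis by blast
qed

end
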